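(* Let $d\ge2$ and let $G=\mathbf{SO}(d)$ or $G=\mathbf{O}(d)$. If $f$ belongs to a finite-dimensional vector subspace $V\subseteq X_d$ such that $\tau_h(V)\subseteq V$ for all $h\in\mathbb{R}^d$ and $O_P(V)\subseteq V$ for all $P\in G$, then $f$ is an ordinary polynomial in $d$ real variables.
   Context: $X_d$ denotes either $C(\mathbb{R}^d)$ (real-valued continuous functions) or $\mathcal{D}(\mathbb{R}^d)'$ (real-valued Schwartz distributions). For $g\in C(\mathbb{R}^d)$: $\tau_hg(x)=g(x+h)$, $O_Pg(x)=g(Px)$. For $f\in\mathcal{D}(\mathbb{R}^d)'$ and test function $\phi$: $\tau_h(f)\{\phi\}=f\{\phi(\cdot-h)\}$, $O_P(f)\{\phi\}=\frac{1}{|\det P|}f\{\phi(P^{-1}\cdot)\}$. A distribution is an ordinary polynomial if it coincides, as a distribution, with an element of $\mathbb{R}[x_1,\dots,x_d]$. *)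

theory Defs
  imports "HOL-Analysis.Analysis"
begin

text \<open>Both C(R^d) and D(R^d)' are represented as real-valued functions on some type
  (points, resp. test functions); vector operations are pointwise.\<close>

definition fin_dim_subspace :: "('a \<Rightarrow> real) set \<Rightarrow> bool" where
  "fin_dim_subspace V \<longleftrightarrow>
     (\<lambda>x. 0) \<in> V \<and>
     (\<forall>f\<in>V. \<forall>g\<in>V. \<forall>a b. (\<lambda>x. a * f x + b * g x) \<in> V) \<and>
     (\<exists>B. finite B \<and> B \<subseteq> V \<and> (\<forall>f\<in>V. \<exists>c. f = (\<lambda>x. \<Sum>b\<in>B. c b * b x)))"

definition poly_fun :: "(real^'n \<Rightarrow> real) \<Rightarrow> bool" where
  "poly_fun g \<longleftrightarrow> (\<exists>N::nat. \<exists>c :: ('n \<Rightarrow> nat) \<Rightarrow> real.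
     g = (\<lambda>x. \<Sum>\<alpha>\<in>{\<alpha>. \<forall>i. \<alpha> i \<le> N}. c \<alpha> * (\<Prod>i\<in>UNIV. (x $ i) ^ (\<alpha> i))))"

definition O_group :: "(real^'n^'n) set" where
  "O_group = {P. orthogonal_matrix P}"

definition SO_group :: "(real^'n^'n) set" where
  "SO_group = {P. orthogonal_matrix P \<and> det P = 1}"

definition tau_fun :: "real^'n \<Rightarrow> (real^'n \<Rightarrow> real) \<Rightarrow> (real^'n \<Rightarrow> real)" where
  "tau_fun h g = (\<lambda>x. g (x + h))"

definition O_fun :: "real^'n^'n \<Rightarrow> (real^'n \<Rightarrow> real) \<Rightarrow> (real^'n \<Rightarrow> real)" where
  "O_fun P g = (\<lambda>x. g (P *v x))"

definition partial :: "'n \<Rightarrow> (real^'n \<Rightarrow> real) \<Rightarrow> (real^'n \<Rightarrow> real)" where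
  "partial i \<phi> = (\<lambda>x. deriv (\<lambda>t. \<phi> (x + t *\<^sub>R axis i 1)) 0)"

fun pds :: "'n list \<Rightarrow> (real^'n \<Rightarrow> real) \<Rightarrow> (real^'n \<Rightarrow> real)" where
  "pds [] \<phi> = \<phi>"
| "pds (i # is) \<phi> = partial i (pds is \<phi>)"

definition smooth_fun :: "(real^'n \<Rightarrow> real) \<Rightarrow> bool" where
  "smooth_fun \<phi> \<longleftrightarrow>
     (\<forall>is. continuous_on UNIV (pds is \<phi>) \<and>
       (\<forall>i x. (\<lambda>t. pds is \<phi> (x + t *\<^sub>R axis i 1)) differentiable (at 0)))"

definition test_fun :: "(real^'n \<Rightarrow> real) \<Rightarrow> bool" where
  "test_fun \<phi> \<longleftrightarrow> smooth_fun \<phi> \<and> compact (closure {x. \<phi> x \<noteq> 0})"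

text \<open>A distribution is a linear functional on test functions satisfying, on every compact K,
  the seminorm estimate |T phi| <= C * max_{|alpha| <= N} sup |D^alpha phi| (Schwartz/Hoermander).
  It is represented as a HOL function that is 0 off the test functions (so that equality of
  distributions is HOL equality).\<close>
definition distribution :: "((real^'n \<Rightarrow> real) \<Rightarrow> real) \<Rightarrow> bool" where
  "distribution T \<longleftrightarrow>
     (\<forall>\<phi>. \<not> test_fun \<phi> \<longrightarrow> T \<phi> = 0) \<and>
     (\<forall>\<phi> \<psi> a b. test_fun \<phi> \<longrightarrow> test_fun \<psi> \<longrightarrow>
        T (\<lambda>x. a * \<phi> x + b * \<psi> x) = a * T \<phi> + b * T \<psi>) \<and>
     (\<forall>K. compact K \<longrightarrow> (\<exists>C N. \<forall>\<phi> M. test_fun \<phi> \<longrightarrow> {x. \<phi> x \<noteq> 0} \<subseteq> K \<longrightarrow>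
        (\<forall>is x. length is \<le> N \<longrightarrow> \<bar>pds is \<phi> x\<bar> \<le> M) \<longrightarrow> \<bar>T \<phi>\<bar> \<le> C * M))"

definition tau_dist :: "real^'n \<Rightarrow> ((real^'n \<Rightarrow> real) \<Rightarrow> real) \<Rightarrow> ((real^'n \<Rightarrow> real) \<Rightarrow> real)" where
  "tau_dist h T = (\<lambda>\<phi>. if test_fun \<phi> then T (\<lambda>x. \<phi> (x - h)) else 0)"

definition O_dist :: "real^'n^'n \<Rightarrow> ((real^'n \<Rightarrow> real) \<Rightarrow> real) \<Rightarrow> ((real^'n \<Rightarrow> real) \<Rightarrow> real)" where
  "O_dist P T = (\<lambda>\<phi>. if test_fun \<phi> then T (\<lambda>x. \<phi> (matrix_inv P *v x)) / \<bar>det P\<bar> else 0)"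

definition poly_dist :: "((real^'n \<Rightarrow> real) \<Rightarrow> real) \<Rightarrow> bool" where
  "poly_dist T \<longleftrightarrow> (\<exists>p. poly_fun p \<and>
     (\<forall>\<phi>. test_fun \<phi> \<longrightarrow> T \<phi> = integral UNIV (\<lambda>x. p x * \<phi> x)))"

end

theory Submission
  imports Defs "HOL-Computational_Algebra.Fundamental_Theorem_Algebra"
begin

text \<open>
  Both cases concern a finite-dimensional space of functions on which translations act by
  composition. Rotations conjugate \<open>\<tau>\<^sub>h\<close> to \<open>\<tau>\<^sub>P\<^sub>h\<close>, so the eigenvalues of \<open>\<tau>\<^sub>h\<close> on the complexification
  depend only on the length of \<open>h\<close>. On a common eigenvector the translations act by a homomorphism
  \<open>\<chi>\<close> that takes finitely many values on a sphere of radius \<open>R\<close>, hence on the ball of radius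
  \<open>2R\<close>, every vector of which is a sum of two vectors of the sphere; divisibility of the vector
  space then forces \<open>\<chi> = 1\<close>. So every \<open>\<tau>\<^sub>h\<close> is unipotent, and Newton's forward difference formula
  makes \<open>k \<mapsto> f(x + k h)\<close> a polynomial of bounded degree on the natural numbers. By continuity
  \<open>f\<close> is a polynomial along every line, and therefore a polynomial.

  For a distribution \<open>T\<close> this shows that \<open>h \<mapsto> T(\<phi>(\<cdot> - h))\<close> is a polynomial of bounded degree for
  every test function \<open>\<phi>\<close>. Evaluating \<open>T(\<phi> * \<psi>)\<close> in two ways gives
  \<open>\<integral> T(\<phi>(\<cdot> - h)) \<psi>(h) dh = \<integral> T(\<psi>(\<cdot> - h)) \<phi>(h) dh\<close>. If the moments of \<open>\<phi>\<close> up to that degree vanish,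
  the right-hand side is zero for all \<open>\<psi>\<close>, so \<open>T \<phi> = 0\<close>. Hence \<open>T\<close> is a linear combination of
  moments, which means that it is given by a polynomial density.
\<close>

section \<open>Unipotence of translations\<close>

text \<open>Gaussian elimination on the equations indexed by \<open>B\<close>: either equation
  \<open>b\<close> is vacuous, or it has a pivot unknown \<open>j\<close>, which is eliminated
  together with it.\<close>

lemma linear_dependence_exists:
  fixes c :: "'i \<Rightarrow> 'b \<Rightarrow> 'a::field"
  assumes "finite B" "finite I" "card B < card I"
  shows "\<exists>a. (\<exists>i\<in>I. a i \<noteq> 0) \<and> (\<forall>b\<in>B. (\<Sum>i\<in>I. a i * c i b) = 0)"
  using assms
proof (induction B arbitrary: I c rule: finite_induct)
  case empty
  then obtain i where "i \<in> I" by fastforce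
  then show ?case by (intro exI[of _ "\<lambda>_. 1"]) auto
next
  case (insert b B)
  show ?case
  proof (cases "\<forall>i\<in>I. c i b = 0")
    case True
    obtain a where "\<exists>i\<in>I. a i \<noteq> 0" "\<forall>b\<in>B. (\<Sum>i\<in>I. a i * c i b) = 0"
      using insert.IH[of I c] insert.prems insert.hyps by auto
    with True show ?thesis by (intro exI[of _ a]) auto
  next
    case False
    then obtain j where j: "j \<in> I" "c j b \<noteq> 0" by auto
    define c' where "c' i b' = c i b' - c i b / c j b * c j b'" for i b'
    have "card B < card (I - {j})"
      using insert.prems insert.hyps j by auto
    then obtain a where a: "\<exists>i\<in>I-{j}. a i \<noteq> 0" "\<forall>b'\<in>B. (\<Sum>i\<in>I-{j}. a i * c' i b') = 0"
      using insert.IH[of "I-{j}" c'] insert.prems by auto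
    \<comment> \<open>The value at \<open>j\<close> solves equation \<open>b\<close> for the pivot
      unknown. By \<open>eq\<close> the other equations then become those with coefficients
      \<open>c'\<close>, while equation \<open>b\<close> becomes trivial because
      \<open>c' i b = 0\<close>.\<close>
    define a' where "a' = a(j := - (\<Sum>i\<in>I-{j}. a i * c i b) / c j b)"
    have eq: "(\<Sum>i\<in>I. a' i * c i b') = (\<Sum>i\<in>I-{j}. a i * c' i b')" for b'
    proof -
      have "(\<Sum>i\<in>I. a' i * c i b') = a' j * c j b' + (\<Sum>i\<in>I-{j}. a' i * c i b')"
        using insert.prems j by (simp add: sum.remove)
      also have "(\<Sum>i\<in>I-{j}. a' i * c i b') = (\<Sum>i\<in>I-{j}. a i * c i b')"
        by (rule sum.cong) (auto simp: a'_def)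
      also have "a' j * c j b' + \<dots> = (\<Sum>i\<in>I-{j}. a i * c' i b')"
        by (simp add: a'_def c'_def algebra_simps sum_subtractf sum_distrib_left sum_divide_distrib)
      finally show ?thesis .
    qed
    have "c' i b = 0" for i using j by (simp add: c'_def)
    then have "\<forall>b'\<in>insert b B. (\<Sum>i\<in>I. a' i * c i b') = 0"
      using a eq by auto
    moreover have "\<exists>i\<in>I. a' i \<noteq> 0" using a by (auto simp: a'_def)
    ultimately show ?thesis by blast
  qed
qed

text \<open>The operator \<open>p(S)\<close>, where \<open>S\<close> is composition with
  \<open>s\<close>. Functions thereby become a module over \<open>complex poly\<close>, and
  factoring polynomials takes the place of a Jordan decomposition.\<close>

definition shift_act :: "complex poly \<Rightarrow> ('a \<Rightarrow> 'a) \<Rightarrow> ('a \<Rightarrow> complex) \<Rightarrow> 'a \<Rightarrow> complex" where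
  "shift_act p s f x = (\<Sum>i\<le>degree p. coeff p i * f ((s ^^ i) x))"

lemma shift_act_altdef:
  assumes "degree p \<le> n"
  shows "shift_act p s f x = (\<Sum>i\<le>n. coeff p i * f ((s ^^ i) x))"
  unfolding shift_act_def
  by (rule sum.mono_neutral_left) (use assms in \<open>auto simp: coeff_eq_0\<close>)

lemma shift_act_0 [simp]: "shift_act 0 s f x = 0"
  by (simp add: shift_act_def)

lemma shift_act_pCons [simp]:
  "shift_act (pCons a p) s f x = a * f x + shift_act p s f (s x)"
proof -
  have "shift_act (pCons a p) s f x
      = (\<Sum>i\<le>Suc (degree p). coeff (pCons a p) i * f ((s ^^ i) x))"
    by (rule shift_act_altdef) (rule degree_pCons_le)
  also have "\<dots> = a * f x + shift_act p s f (s x)"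
    unfolding shift_act_def by (subst sum.atMost_Suc_shift) (simp add: funpow_swap1)
  finally show ?thesis .
qed

lemma shift_act_1 [simp]: "shift_act 1 s f x = f x"
  by (simp add: one_pCons)

lemma shift_act_add: "shift_act (p + q) s f x = shift_act p s f x + shift_act q s f x"
proof -
  let ?n = "max (degree p) (degree q)"
  have "degree (p + q) \<le> ?n" by (rule degree_add_le) auto
  then show ?thesis
    by (simp add: shift_act_altdef[of _ ?n] sum.distrib algebra_simps)
qed

lemma shift_act_smult: "shift_act (smult a p) s f x = a * shift_act p s f x"
  by (induction p arbitrary: x) (simp_all add: algebra_simps)

lemma shift_act_mult: "shift_act (p * q) s f x = shift_act p s (shift_act q s f) x"
  by (induction p arbitrary: x) (simp_all add: shift_act_add shift_act_smult)

lemma shift_act_sum: "shift_act (\<Sum>i\<in>A. p i) s f x = (\<Sum>i\<in>A. shift_act (p i) s f x)"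
  by (induction A rule: infinite_finite_induct) (simp_all add: shift_act_add)

lemma shift_act_zero_fun [simp]: "shift_act p s (\<lambda>_. 0) x = 0"
  by (simp add: shift_act_def)

lemma shift_act_of_nat: "shift_act (of_nat n) s f x = of_nat n * f x"
  by (simp add: of_nat_poly)

lemma shift_act_X_power: "shift_act ([:0, 1:] ^ k) s f x = f ((s ^^ k) x)"
  by (induction k arbitrary: x) (simp_all add: shift_act_mult funpow_swap1)

lemma shift_act_eigen:
  assumes "\<And>x. f (s x) = z * f x"
  shows "shift_act p s f x = poly p z * f x"
  by (induction p arbitrary: x) (simp_all add: assms algebra_simps)

lemma shift_act_lincomb:
  "shift_act p s (\<lambda>x. \<Sum>b\<in>B. c b * g b x) x = (\<Sum>b\<in>B. c b * shift_act p s (g b) x)"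
proof -
  have "shift_act p s (\<lambda>x. \<Sum>b\<in>B. c b * g b x) x
      = (\<Sum>i\<le>degree p. \<Sum>b\<in>B. coeff p i * (c b * g b ((s ^^ i) x)))"
    by (simp add: shift_act_def sum_distrib_left)
  also have "\<dots> = (\<Sum>b\<in>B. \<Sum>i\<le>degree p. coeff p i * (c b * g b ((s ^^ i) x)))"
    by (rule sum.swap)
  finally show ?thesis by (simp add: shift_act_def sum_distrib_left algebra_simps)
qed

text \<open>Newton's forward difference formula: \<open>[:-1, 1:]\<close> acts as the difference
  operator \<open>S - 1\<close>, and the binomial theorem expands
  \<open>S ^ k = ((S - 1) + 1) ^ k\<close>.\<close>

lemma shift_act_newton:
  "f ((s ^^ k) x) = (\<Sum>j\<le>k. of_nat (k choose j) * shift_act ([:-1, 1:] ^ j) s f x)"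
proof -
  have X: "[:0, 1:] = [:-1, 1::complex:] + 1" by (simp add: one_pCons)
  have "f ((s ^^ k) x) = shift_act (([:-1, 1:] + 1) ^ k) s f x"
    by (metis X shift_act_X_power)
  also have "\<dots> = (\<Sum>j\<le>k. of_nat (k choose j) * shift_act ([:-1, 1:] ^ j) s f x)"
    by (subst binomial_ring) (simp add: shift_act_sum shift_act_mult shift_act_of_nat)
  finally show ?thesis .
qed

section \<open>Eigenvectors of commuting translations\<close>

text \<open>The common frame of the two cases: \<open>'a\<close> consists of points or of functions
  to be tested, and \<open>s\<close> is an action of the additive group of \<open>'v\<close>. Only
  finite dimension and invariance are assumed here; continuity enters later.\<close>

locale translation_space =
  fixes V :: "('a \<Rightarrow> real) set" and s :: "'v::euclidean_space \<Rightarrow> 'a \<Rightarrow> 'a"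
  assumes fin_dim: "fin_dim_subspace V"
    and s_zero [simp]: "s 0 x = x"
    and s_add: "s h (s k x) = s (h + k) x"
    and invariant: "f \<in> V \<Longrightarrow> (\<lambda>x. f (s h x)) \<in> V"
begin

definition VC :: "('a \<Rightarrow> complex) set" where
  "VC = {v. (\<lambda>x. Re (v x)) \<in> V \<and> (\<lambda>x. Im (v x)) \<in> V}"

definition invariant_subspace :: "('a \<Rightarrow> complex) set \<Rightarrow> bool" where
  "invariant_subspace W \<longleftrightarrow> W \<subseteq> VC \<and>
     (\<forall>v\<in>W. \<forall>w\<in>W. \<forall>a b. (\<lambda>x. a * v x + b * w x) \<in> W) \<and>
     (\<forall>v\<in>W. \<forall>h. (\<lambda>x. v (s h x)) \<in> W)"

lemma invariant_subspace_lincomb: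
  "invariant_subspace W \<Longrightarrow> v \<in> W \<Longrightarrow> w \<in> W \<Longrightarrow> (\<lambda>x. a * v x + b * w x) \<in> W"
  by (simp add: invariant_subspace_def)

lemma invariant_subspace_shift:
  "invariant_subspace W \<Longrightarrow> v \<in> W \<Longrightarrow> (\<lambda>x. v (s h x)) \<in> W"
  by (simp add: invariant_subspace_def)

lemma s_funpow: "(s h ^^ i) x = s (real i *\<^sub>R h) x"
  by (induction i) (simp_all add: s_add algebra_simps)

lemma V_lincomb: "f \<in> V \<Longrightarrow> g \<in> V \<Longrightarrow> (\<lambda>x. a * f x + b * g x) \<in> V"
  using fin_dim by (auto simp: fin_dim_subspace_def)

lemma VC_lincomb:
  assumes "v \<in> VC" "w \<in> VC"
  shows "(\<lambda>x. a * v x + b * w x) \<in> VC"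
proof -
  have v: "(\<lambda>x. Re (v x)) \<in> V" "(\<lambda>x. Im (v x)) \<in> V" and w: "(\<lambda>x. Re (w x)) \<in> V" "(\<lambda>x. Im (w x)) \<in> V"
    using assms by (auto simp: VC_def)
  have "(\<lambda>x. 1 * (Re a * Re (v x) + (- Im a) * Im (v x)) + 1 * (Re b * Re (w x) + (- Im b) * Im (w x))) \<in> V"
    by (intro V_lincomb v w)
  moreover have "(\<lambda>x. 1 * (Re a * Im (v x) + Im a * Re (v x)) + 1 * (Re b * Im (w x) + Im b * Re (w x))) \<in> V"
    by (intro V_lincomb v w)
  ultimately show ?thesis by (simp add: VC_def algebra_simps)
qed

lemma invariant_subspace_VC: "invariant_subspace VC"
  unfolding invariant_subspace_def
  using VC_lincomb invariant by (auto simp: VC_def)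

lemma shift_act_in:
  assumes "invariant_subspace W" "v \<in> W"
  shows "shift_act p (s h) v \<in> W"
proof (induction p)
  case 0
  have "(\<lambda>x. 0 * v x + 0 * v x) \<in> W"
    by (intro invariant_subspace_lincomb assms)
  then show ?case by (simp add: shift_act_def)
next
  case (pCons a p)
  have "(\<lambda>x. shift_act p (s h) v (s h x)) \<in> W"
    by (rule invariant_subspace_shift[OF assms(1) pCons(2)])
  then have "(\<lambda>x. a * v x + 1 * shift_act p (s h) v (s h x)) \<in> W"
    by (rule invariant_subspace_lincomb[OF assms])
  moreover have "shift_act (pCons a p) (s h) v = (\<lambda>x. a * v x + shift_act p (s h) v (s h x))"
    by (rule ext) simp
  ultimately show ?case by simp
qed

lemma VC_span:
  obtains B where "finite B" "B \<subseteq> V"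
    "\<And>v. v \<in> VC \<Longrightarrow> \<exists>c. v = (\<lambda>x. \<Sum>b\<in>B. c b * complex_of_real (b x))"
proof -
  obtain B where B: "finite B" "B \<subseteq> V" "\<And>f. f \<in> V \<Longrightarrow> \<exists>c. f = (\<lambda>x. \<Sum>b\<in>B. c b * b x)"
    using fin_dim unfolding fin_dim_subspace_def by blast
  have "\<exists>c. v = (\<lambda>x. \<Sum>b\<in>B. c b * complex_of_real (b x))" if "v \<in> VC" for v
  proof -
    obtain c where c: "(\<lambda>x. Re (v x)) = (\<lambda>x. \<Sum>b\<in>B. c b * b x)"
      using B(3) \<open>v \<in> VC\<close> VC_def by blast
    obtain d where d: "(\<lambda>x. Im (v x)) = (\<lambda>x. \<Sum>b\<in>B. d b * b x)"
      using B(3) \<open>v \<in> VC\<close> VC_def by blast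
    have "v x = (\<Sum>b\<in>B. Complex (c b) (d b) * complex_of_real (b x))" for x
      using fun_cong[OF c, of x] fun_cong[OF d, of x] by (simp add: complex_eq_iff)
    then show ?thesis by (intro exI[of _ "\<lambda>b. Complex (c b) (d b)"]) auto
  qed
  with B show ?thesis using that by blast
qed

text \<open>With \<open>n\<close> the size of a spanning set, the \<open>n + 1\<close> functions
  \<open>v, S v, ..., S^n v\<close> are linearly dependent. The bound does not depend on
  \<open>v\<close> or \<open>h\<close>, which later gives one degree bound for all lines and all
  test functions.\<close>

lemma annihilating_poly:
  "\<exists>n. \<forall>v\<in>VC. \<forall>h. \<exists>p. p \<noteq> 0 \<and> degree p \<le> n \<and> (\<forall>x. shift_act p (s h) v x = 0)"
proof -
  obtain B where B: "finite B" "B \<subseteq> V"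
    "\<And>v. v \<in> VC \<Longrightarrow> \<exists>c. v = (\<lambda>x. \<Sum>b\<in>B. c b * complex_of_real (b x))"
    using VC_span by blast
  let ?n = "card B"
  have "\<exists>p. p \<noteq> 0 \<and> degree p \<le> ?n \<and> (\<forall>x. shift_act p (s h) v x = 0)" if v: "v \<in> VC" for v h
  proof -
    have "(\<lambda>x. v (s (real i *\<^sub>R h) x)) \<in> VC" for i
      by (rule invariant_subspace_shift[OF invariant_subspace_VC v])
    then have "\<forall>i. \<exists>c. (\<lambda>x. v (s (real i *\<^sub>R h) x)) = (\<lambda>x. \<Sum>b\<in>B. c b * complex_of_real (b x))"
      using B(3) by blast
    then obtain c where c: "\<And>i. (\<lambda>x. v (s (real i *\<^sub>R h) x)) = (\<lambda>x. \<Sum>b\<in>B. c i b * complex_of_real (b x))"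
      by metis
    obtain a where a: "\<exists>i\<in>{..?n}. a i \<noteq> 0" "\<forall>b\<in>B. (\<Sum>i\<in>{..?n}. a i * c i b) = 0"
      using linear_dependence_exists[OF B(1), of "{..?n}" c] by auto
    define p where "p = (\<Sum>i\<le>?n. monom (a i) i)"
    have cp: "coeff p i = (if i \<le> ?n then a i else 0)" for i
      by (simp add: p_def coeff_sum)
    have "p \<noteq> 0" using a(1) cp by (metis atMost_iff coeff_0)
    moreover have deg: "degree p \<le> ?n" by (rule degree_le) (simp add: cp)
    moreover have "shift_act p (s h) v x = 0" for x
    proof -
      have "shift_act p (s h) v x = (\<Sum>i\<le>?n. a i * v (s (real i *\<^sub>R h) x))"
        unfolding shift_act_altdef[OF deg] by (rule sum.cong) (auto simp: cp s_funpow)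
      also have "\<dots> = (\<Sum>i\<le>?n. \<Sum>b\<in>B. a i * (c i b * complex_of_real (b x)))"
        using c by (simp add: fun_eq_iff sum_distrib_left)
      also have "\<dots> = (\<Sum>b\<in>B. (\<Sum>i\<le>?n. a i * c i b) * complex_of_real (b x))"
        by (subst sum.swap) (simp add: sum_distrib_right mult.assoc)
      finally show ?thesis using a(2) by simp
    qed
    ultimately show ?thesis by blast
  qed
  then show ?thesis by blast
qed

text \<open>If \<open>(X - z) q\<close> annihilates \<open>v\<close>, then either \<open>q\<close>
  already does, and the degree drops, or \<open>q\<close> applied to \<open>v\<close> is an
  eigenvector for \<open>z\<close>. Invariance keeps this eigenvector inside
  \<open>W\<close>.\<close>

lemma poly_eigenvector_exists:
  assumes "invariant_subspace W" "v \<in> W" "v \<noteq> (\<lambda>_. 0)" "p \<noteq> 0"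
    "\<And>x. shift_act p (s h) v x = 0"
  shows "\<exists>z. \<exists>w\<in>W. w \<noteq> (\<lambda>_. 0) \<and> (\<forall>x. w (s h x) = z * w x)"
  using assms(4,5)
proof (induction "degree p" arbitrary: p rule: less_induct)
  case less
  show ?case
  proof (cases "degree p = 0")
    case True
    then obtain a where "p = [:a:]" by (meson degree_eq_zeroE)
    with less.prems assms(3) show ?thesis by (auto simp: fun_eq_iff)
  next
    case False
    then have "\<not> constant (poly p)" by (simp add: constant_degree)
    then obtain z where "poly p z = 0" using fundamental_theorem_of_algebra by blast
    then obtain q where q: "p = [:-z, 1:] * q" by (metis dvdE poly_eq_0_iff_dvd)
    have q0: "q \<noteq> 0" using q less.prems by auto
    have deg: "degree q < degree p" unfolding q by (subst degree_mult_eq) (use q0 in auto)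
    let ?w = "shift_act q (s h) v"
    show ?thesis
    proof (cases "\<forall>x. ?w x = 0")
      case True
      then show ?thesis using less.hyps[OF deg q0] by blast
    next
      case False
      have "?w \<in> W" using shift_act_in assms by blast
      moreover have "?w (s h x) = z * ?w x" for x
        using less.prems(2)[of x] unfolding q shift_act_mult by simp
      ultimately show ?thesis using False by (intro exI[of _ z] bexI[of _ ?w]) auto
    qed
  qed
qed

lemma eigenvector_exists:
  assumes "invariant_subspace W" "v \<in> W" "v \<noteq> (\<lambda>_. 0)"
  shows "\<exists>z. \<exists>w\<in>W. w \<noteq> (\<lambda>_. 0) \<and> (\<forall>x. w (s h x) = z * w x)"
proof -
  obtain n where n: "\<forall>v\<in>VC. \<forall>h. \<exists>p. p \<noteq> 0 \<and> degree p \<le> n \<and> (\<forall>x. shift_act p (s h) v x = 0)"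
    using annihilating_poly by (elim exE)
  have "v \<in> VC" using assms unfolding invariant_subspace_def by blast
  then obtain p where "p \<noteq> 0" "\<forall>x. shift_act p (s h) v x = 0" using n by blast
  then show ?thesis using poly_eigenvector_exists[OF assms] by blast
qed

text \<open>Translations commute, so each of them preserves the eigenspaces of the others. This
  makes successive restriction to eigenspaces possible.\<close>

lemma eigenspace_invariant:
  assumes "invariant_subspace W"
  shows "invariant_subspace {v \<in> W. \<forall>x. v (s h x) = z * v x}"
proof -
  have "s k (s h x) = s h (s k x)" for k x by (simp add: s_add add.commute)
  then show ?thesis
    using assms unfolding invariant_subspace_def by (auto simp: algebra_simps subset_iff)
qed

text \<open>Each translation in the list is treated in turn by passing to one of its eigenspaces, on
  which the remaining ones still act. A finite list is enough for the pigeonhole argument in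
  \<open>eigenvalue_one\<close>.\<close>

lemma common_eigenvector_exists:
  assumes "invariant_subspace W" "v \<in> W" "v \<noteq> (\<lambda>_. 0)"
  shows "\<exists>w\<in>W. w \<noteq> (\<lambda>_. 0) \<and> (\<forall>h\<in>set hs. \<exists>z. \<forall>x. w (s h x) = z * w x)"
  using assms
proof (induction hs arbitrary: W v)
  case Nil
  show ?case by (intro bexI[of _ v] conjI Nil) simp
next
  case (Cons h hs)
  obtain z w where w: "w \<in> W" "w \<noteq> (\<lambda>_. 0)" "\<forall>x. w (s h x) = z * w x"
    using eigenvector_exists[OF Cons.prems] by blast
  let ?W = "{v \<in> W. \<forall>x. v (s h x) = z * v x}"
  have W: "invariant_subspace ?W" by (rule eigenspace_invariant) fact
  have "w \<in> ?W" using w by simp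
  from Cons.IH[OF W this w(2)] obtain u where
    u: "u \<in> ?W" "u \<noteq> (\<lambda>_. 0)" "\<forall>h\<in>set hs. \<exists>z. \<forall>x. u (s h x) = z * u x" by (elim bexE conjE)
  have "\<exists>z. \<forall>x. u (s k x) = z * u x" if "k \<in> set (h # hs)" for k
  proof (cases "k = h")
    case True
    then show ?thesis using u(1) by blast
  next
    case False
    then show ?thesis using u(3) that by simp
  qed
  then show ?case using u(1,2) by blast
qed

text \<open>The product of annihilating polynomials for the finitely many spanning functions
  annihilates all of \<open>VC\<close>, so every eigenvalue is one of its roots.\<close>

lemma finite_eigenvalues:
  "finite {z. \<exists>w\<in>VC. w \<noteq> (\<lambda>_. 0) \<and> (\<forall>x. w (s h x) = z * w x)}"
proof -
  obtain B where B: "finite B" "B \<subseteq> V"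
    "\<And>v. v \<in> VC \<Longrightarrow> \<exists>c. v = (\<lambda>x. \<Sum>b\<in>B. c b * complex_of_real (b x))"
    using VC_span by blast
  obtain n where n: "\<forall>v\<in>VC. \<forall>h. \<exists>p. p \<noteq> 0 \<and> degree p \<le> n \<and> (\<forall>x. shift_act p (s h) v x = 0)"
    using annihilating_poly by (elim exE)
  have zero: "(\<lambda>x. 0) \<in> V" using fin_dim by (auto simp: fin_dim_subspace_def)
  have "\<forall>b\<in>B. \<exists>p. p \<noteq> 0 \<and> (\<forall>x. shift_act p (s h) (\<lambda>x. complex_of_real (b x)) x = 0)"
  proof
    fix b assume "b \<in> B"
    then have "(\<lambda>x. complex_of_real (b x)) \<in> VC" using B zero by (auto simp: VC_def)
    then show "\<exists>p. p \<noteq> 0 \<and> (\<forall>x. shift_act p (s h) (\<lambda>x. complex_of_real (b x)) x = 0)"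
      using n by blast
  qed
  then obtain p where p: "\<And>b. b \<in> B \<Longrightarrow> p b \<noteq> 0"
    "\<And>b x. b \<in> B \<Longrightarrow> shift_act (p b) (s h) (\<lambda>x. complex_of_real (b x)) x = 0" by metis
  define P where "P = (\<Prod>b\<in>B. p b)"
  have P0: "P \<noteq> 0" using p B(1) by (simp add: P_def)
  have Pb: "shift_act P (s h) (\<lambda>x. complex_of_real (b x)) x = 0" if "b \<in> B" for b x
  proof -
    have "P = (\<Prod>b\<in>B-{b}. p b) * p b"
      using that B(1) by (simp add: P_def prod.remove mult.commute)
    moreover have "shift_act (p b) (s h) (\<lambda>x. complex_of_real (b x)) = (\<lambda>_. 0)"
      using p that by blast
    ultimately show ?thesis by (simp add: shift_act_mult)
  qed
  have "poly P z = 0" if w: "w \<in> VC" "w \<noteq> (\<lambda>_. 0)" "\<forall>x. w (s h x) = z * w x" for z w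
  proof -
    obtain x where x: "w x \<noteq> 0" using w(2) by auto
    obtain c where c: "w = (\<lambda>x. \<Sum>b\<in>B. c b * complex_of_real (b x))" using B(3) w by blast
    have "shift_act P (s h) w x = 0"
      unfolding c shift_act_lincomb[where g = "\<lambda>b x. complex_of_real (b x)"] using Pb by simp
    then show ?thesis using shift_act_eigen[of w "s h" z P x] w(3) x by simp
  qed
  then show ?thesis
    by (intro finite_subset[OF _ poly_roots_finite[OF P0]]) auto
qed

end

section \<open>Rotations and the eigenvalues of translations\<close>

text \<open>\<open>r_s\<close> is the commutation relation in the group of rigid motions.
  \<open>r_surj\<close> is the form in which surjectivity of \<open>r P\<close> is used: composition
  with it is injective on \<open>V\<close>. Working with \<open>SO_group\<close> covers both choices
  of the group, since it is contained in \<open>O_group\<close>.\<close>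

locale motion_space = translation_space V s
  for V :: "('a \<Rightarrow> real) set" and s :: "real^'n \<Rightarrow> 'a \<Rightarrow> 'a" +
  fixes r :: "real^'n^'n \<Rightarrow> 'a \<Rightarrow> 'a"
  assumes dim: "CARD('n) \<ge> 2"
    and r_invariant: "P \<in> SO_group \<Longrightarrow> f \<in> V \<Longrightarrow> (\<lambda>x. f (r P x)) \<in> V"
    and r_surj: "P \<in> SO_group \<Longrightarrow> f \<in> V \<Longrightarrow> (\<And>x. f (r P x) = 0) \<Longrightarrow> f x = 0"
    and r_s: "P \<in> SO_group \<Longrightarrow> r P (s h x) = s (P *v h) (r P x)"
begin

text \<open>In dimension at least 2 some rotation \<open>P\<close> takes \<open>a\<close> to
  \<open>b\<close>. Composing an eigenvector of \<open>s b\<close> with \<open>r P\<close> gives an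
  eigenvector of \<open>s a\<close> for the same \<open>z\<close>, nonzero by
  \<open>r_surj\<close>.\<close>

lemma eigenvalue_rotate:
  assumes "norm a = norm b" "w \<in> VC" "w \<noteq> (\<lambda>_. 0)" "\<forall>x. w (s b x) = z * w x"
  shows "\<exists>w\<in>VC. w \<noteq> (\<lambda>_. 0) \<and> (\<forall>x. w (s a x) = z * w x)"
proof -
  obtain f where f: "orthogonal_transformation f" "det (matrix f) = 1" "f a = b"
    using rotation_exists[OF dim assms(1)] by blast
  let ?P = "matrix f"
  have P: "?P \<in> SO_group"
    using f by (auto simp: SO_group_def orthogonal_transformation_matrix)
  have Pa: "?P *v a = b"
    using f(3) matrix_works[of f] orthogonal_transformation_linear[OF f(1)] by simp
  let ?w = "\<lambda>x. w (r ?P x)"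
  have "?w \<in> VC" using assms(2) r_invariant[OF P] by (auto simp: VC_def)
  moreover have "?w \<noteq> (\<lambda>_. 0)"
  proof
    assume "?w = (\<lambda>_. 0)"
    then have *: "w (r ?P x) = 0" for x by (rule fun_cong)
    have "Re (w x) = 0" "Im (w x) = 0" for x
      using r_surj[OF P, of "\<lambda>x. Re (w x)" x] r_surj[OF P, of "\<lambda>x. Im (w x)" x] assms(2) *
      by (auto simp: VC_def)
    then show False using assms(3) by (auto simp: complex_eq_iff fun_eq_iff)
  qed
  moreover have "?w (s a x) = z * ?w x" for x
    using assms(4) by (simp add: r_s[OF P] Pa)
  ultimately show ?thesis by blast
qed

text \<open>A rhombus with diagonal \<open>u\<close>: its sides are \<open>u / 2\<close> plus and
  minus a multiple of some \<open>y\<close> orthogonal to \<open>u\<close>, and Pythagoras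
  determines the multiple \<open>t\<close>. Dimension at least 2 provides \<open>y\<close>.\<close>

lemma sum_of_two_on_sphere:
  fixes u :: "real^'n"
  assumes "norm u \<le> 2 * R"
  shows "\<exists>a b. norm a = R \<and> norm b = R \<and> u = a + b"
proof -
  have "2 \<le> DIM(real^'n)" using dim by simp
  then obtain y where y: "y \<noteq> 0" "orthogonal u y"
    using orthogonal_to_vector_exists by blast
  have R: "0 \<le> R" using assms norm_ge_zero[of u] by linarith
  have "(norm u)\<^sup>2 \<le> (2 * R)\<^sup>2" by (rule power_mono[OF assms]) simp
  then have nn: "0 \<le> R\<^sup>2 - (norm u)\<^sup>2 / 4" by (simp add: power_mult_distrib)
  define t where "t = sqrt (R\<^sup>2 - (norm u)\<^sup>2 / 4) / norm y"
  have t2: "t\<^sup>2 * (norm y)\<^sup>2 = R\<^sup>2 - (norm u)\<^sup>2 / 4"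
    using y nn by (simp add: t_def power_divide)
  have uy: "u \<bullet> y = 0" using y by (simp add: orthogonal_def)
  have n: "norm ((1/2) *\<^sub>R u + c *\<^sub>R y) = R" if "c\<^sup>2 = t\<^sup>2" for c
  proof -
    have "(norm ((1/2) *\<^sub>R u + c *\<^sub>R y))\<^sup>2 = (norm u)\<^sup>2 / 4 + c\<^sup>2 * (norm y)\<^sup>2"
      unfolding power2_norm_eq_inner
      using uy inner_commute[of y u] by (simp add: inner_simps power2_eq_square)
    also have "\<dots> = R\<^sup>2" using t2 that by simp
    finally show ?thesis using R by (simp add: power2_eq_iff_nonneg)
  qed
  have "u = ((1/2) *\<^sub>R u + t *\<^sub>R y) + ((1/2) *\<^sub>R u + (-t) *\<^sub>R y)"
    by (simp add: scaleR_half_double flip: scaleR_left_distrib)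
  then show ?thesis using n[of t] n[of "-t"] by fastforce
qed

lemma eigenvalue_one:
  assumes v: "v \<in> VC" "v \<noteq> (\<lambda>_. 0)" "\<forall>x. v (s w x) = z * v x"
  shows "z = 1"
proof -
  define R where "R = norm w"
  define S where "S = {z. \<exists>v\<in>VC. v \<noteq> (\<lambda>_. 0) \<and> (\<forall>x. v (s w x) = z * v x)}"
  have finS: "finite S" unfolding S_def by (rule finite_eigenvalues)
  \<comment> \<open>By \<open>eigenvalue_rotate\<close>, \<open>S\<close> contains the eigenvalues
    of every translation of length \<open>R\<close>. On a common eigenvector, the eigenvalue of a
    translation by a sum of two such vectors is therefore a product in \<open>Q\<close>.\<close>
  define Q where "Q = (\<lambda>(a, b). a * b) ` (S \<times> S)"
  have finQ: "finite Q" using finS by (simp add: Q_def)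
  define N where "N = card Q"
  \<comment> \<open>If \<open>\<zeta>\<close> is the eigenvalue at \<open>w'\<close>, pigeonhole on its powers in \<open>Q\<close> gives \<open>\<zeta> ^ m = 1\<close> for some
    \<open>1 \<le> m \<le> N\<close>; scaling by \<open>fact N\<close> covers every such \<open>m\<close>.\<close>
  define w' where "w' = (1 / fact N) *\<^sub>R w"
  have "\<exists>a b. norm a = R \<and> norm b = R \<and> real k *\<^sub>R w' = a + b" if "k \<le> N" for k
  proof (rule sum_of_two_on_sphere)
    have "real k \<le> fact N"
    proof -
      have "k \<le> fact N" using that fact_ge_self le_trans by blast
      then show ?thesis by (metis of_nat_fact of_nat_le_iff)
    qed
    then have "norm (real k *\<^sub>R w') \<le> R"
      by (simp add: w'_def R_def divide_le_eq mult_right_mono mult.commute)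
    then show "norm (real k *\<^sub>R w') \<le> 2 * R" using norm_ge_zero[of w] unfolding R_def by linarith
  qed
  then obtain a b where ab: "\<And>k. k \<le> N \<Longrightarrow> norm (a k) = R \<and> norm (b k) = R \<and> real k *\<^sub>R w' = a k + b k"
    by metis
  let ?hs = "w' # map a [0..<Suc N] @ map b [0..<Suc N]"
  \<comment> \<open>Searching inside the \<open>z\<close>-eigenspace of \<open>s w\<close> makes the
    common eigenvector \<open>u\<close> retain the eigenvalue \<open>z\<close> in question.\<close>
  let ?W = "{v \<in> VC. \<forall>x. v (s w x) = z * v x}"
  have "invariant_subspace ?W" by (intro eigenspace_invariant invariant_subspace_VC)
  from common_eigenvector_exists[OF this, of v ?hs] v obtain u where
    u: "u \<in> VC" "u \<noteq> (\<lambda>_. 0)" "\<forall>x. u (s w x) = z * u x"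
      "\<forall>h\<in>set ?hs. \<exists>z. \<forall>x. u (s h x) = z * u x" by blast
  obtain x0 where x0: "u x0 \<noteq> 0" using u(2) by auto
  obtain \<zeta> where \<zeta>: "\<And>x. u (s w' x) = \<zeta> * u x" using u(4) by auto
  have pow: "u (s (real k *\<^sub>R w') x) = \<zeta> ^ k * u x" for k x
  proof (induction k arbitrary: x)
    case (Suc k)
    have "s (real (Suc k) *\<^sub>R w') x = s w' (s (real k *\<^sub>R w') x)"
      by (simp add: s_add algebra_simps)
    then show ?case using Suc \<zeta> by (simp add: algebra_simps)
  qed simp
  have inQ: "\<zeta> ^ k \<in> Q" if k: "k \<le> N" for k
  proof -
    have "a k \<in> set ?hs" "b k \<in> set ?hs" using k by (auto simp del: upt_Suc)
    then obtain \<alpha> \<beta> where \<alpha>: "\<And>x. u (s (a k) x) = \<alpha> * u x" and \<beta>: "\<And>x. u (s (b k) x) = \<beta> * u x"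
      using u(4) by meson
    have "\<alpha> \<in> S" "\<beta> \<in> S"
      unfolding S_def using eigenvalue_rotate[of w "a k" u \<alpha>] eigenvalue_rotate[of w "b k" u \<beta>]
        ab[OF k] u \<alpha> \<beta> by (auto simp: R_def)
    moreover have "\<zeta> ^ k * u x0 = \<alpha> * \<beta> * u x0"
      using pow[of k x0] ab[OF k] \<alpha> \<beta> by (auto simp: s_add[symmetric])
    ultimately show ?thesis using x0 by (auto simp: Q_def)
  qed
  have "\<zeta> \<noteq> 0"
  proof
    assume "\<zeta> = 0"
    then have "u (s w' (s (-w') x0)) = 0" using \<zeta> by simp
    then show False using x0 by (simp add: s_add)
  qed
  have "\<not> inj_on (\<lambda>k. \<zeta> ^ k) {..N}"
  proof
    assume "inj_on (\<lambda>k. \<zeta> ^ k) {..N}"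
    then have "card {..N} \<le> card Q" using inQ finQ by (intro card_inj_on_le) auto
    then show False by (simp add: N_def)
  qed
  then obtain i j where ij: "i < j" "j \<le> N" "\<zeta> ^ i = \<zeta> ^ j"
    unfolding inj_on_def by (metis atMost_iff linorder_neqE_nat)
  have "\<zeta> ^ j = \<zeta> ^ i * \<zeta> ^ (j - i)" using ij(1) by (simp flip: power_add)
  then have one: "\<zeta> ^ (j - i) = 1" using ij(3) \<open>\<zeta> \<noteq> 0\<close> by simp
  have "(j - i) dvd fact N" using ij by (intro dvd_fact) auto
  then obtain m where m: "fact N = (j - i) * m" by (elim dvdE)
  then have "\<zeta> ^ fact N = 1" using one by (simp add: power_mult)
  moreover have "real (fact N) *\<^sub>R w' = w" by (simp add: w'_def)
  ultimately have "u (s w x0) = u x0" using pow[of "fact N" x0] by simp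
  then show ?thesis using u(3) x0 by simp
qed

text \<open>Roots of \<open>p\<close> are split off one by one. A root 1 contributes a factor
  \<open>X - 1\<close>, which is moved onto \<open>v\<close>. For a root \<open>z\<close> other than
  1 the factor is dropped, because \<open>q\<close> applied to \<open>v\<close> would otherwise be
  an eigenvector contradicting \<open>eigenvalue_one\<close>.\<close>

lemma unipotent:
  assumes "v \<in> VC" "p \<noteq> 0" "\<And>x. shift_act p (s h) v x = 0"
  shows "shift_act ([:-1, 1:] ^ degree p) (s h) v x = 0"
  using assms
proof (induction "degree p" arbitrary: p v x)
  case 0
  obtain a where a: "p = [:a:]" using 0(1) degree_eq_zeroE by metis
  show ?case using 0(4)[of x] 0(3) by (simp add: a)
next
  case (Suc n)
  have "\<not> constant (poly p)" using Suc.hyps(2) by (simp add: constant_degree)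
  then obtain z where "poly p z = 0" using fundamental_theorem_of_algebra by blast
  then obtain q where q: "p = [:-z, 1:] * q" by (metis dvdE poly_eq_0_iff_dvd)
  have q0: "q \<noteq> 0" using q Suc.prems(2) by auto
  have deg: "degree p = Suc (degree q)" unfolding q by (subst degree_mult_eq) (use q0 in auto)
  then have n: "n = degree q" using Suc.hyps(2) by simp
  have VCa: "shift_act r (s h) v \<in> VC" for r
    using shift_act_in[OF invariant_subspace_VC Suc.prems(1)] .
  show ?case
  proof (cases "z = 1")
    case True
    have "p = q * [:-1, 1:]" using q True by (simp only: mult.commute)
    then have "shift_act q (s h) (shift_act [:-1, 1:] (s h) v) x = 0" for x
      using Suc.prems(3)[of x] by (simp only: shift_act_mult)
    from Suc.hyps(1)[OF n VCa q0 this] show ?thesis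
      by (simp only: deg power_Suc2 shift_act_mult)
  next
    case False
    let ?u = "shift_act q (s h) v"
    have "?u (s h x) = z * ?u x" for x
      using Suc.prems(3)[of x] unfolding q shift_act_mult by simp
    then have "?u = (\<lambda>_. 0)" using eigenvalue_one[OF VCa] False by blast
    then have "?u x = 0" for x by (rule fun_cong)
    from Suc.hyps(1)[OF n Suc.prems(1) q0 this]
    have "shift_act ([:-1, 1:] ^ degree q) (s h) v = (\<lambda>_. 0)" by (rule ext)
    then show ?thesis by (simp only: deg power_Suc shift_act_mult shift_act_zero_fun)
  qed
qed

text \<open>Unipotence makes all differences of order above \<open>n\<close> vanish, which truncates
  Newton's formula at an order common to all \<open>f\<close>, \<open>h\<close> and
  \<open>x\<close>. The coefficients \<open>d\<close> are real parts of iterated differences at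
  \<open>x\<close>.\<close>

theorem newton_expansion:
  "\<exists>n. \<forall>f\<in>V. \<forall>h x. \<exists>d. \<forall>k. f (s (real k *\<^sub>R h) x) = (\<Sum>j\<le>n. real (k choose j) * d j)"
proof -
  obtain n where n: "\<forall>v\<in>VC. \<forall>h. \<exists>p. p \<noteq> 0 \<and> degree p \<le> n \<and> (\<forall>x. shift_act p (s h) v x = 0)"
    using annihilating_poly by (elim exE)
  have "\<exists>d. \<forall>k. f (s (real k *\<^sub>R h) x) = (\<Sum>j\<le>n. real (k choose j) * d j)" if f: "f \<in> V" for f h x
  proof -
    let ?v = "\<lambda>x. complex_of_real (f x)"
    have "(\<lambda>x. 0) \<in> V" using fin_dim by (auto simp: fin_dim_subspace_def)
    then have v: "?v \<in> VC" using f by (simp add: VC_def)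
    then obtain p where p: "p \<noteq> 0" "degree p \<le> n" "\<forall>x. shift_act p (s h) ?v x = 0"
      using n by blast
    let ?D = "\<lambda>j. shift_act ([:-1, 1:] ^ j) (s h) ?v x"
    have D0: "?D j = 0" if "j > n" for j
    proof -
      have j: "[:-1, 1::complex:] ^ j = [:-1, 1:] ^ (j - degree p) * [:-1, 1:] ^ degree p"
        using that p by (simp flip: power_add)
      have "shift_act ([:-1, 1:] ^ degree p) (s h) ?v = (\<lambda>_. 0)"
        using unipotent[OF v p(1)] p(3) by blast
      then show ?thesis by (simp only: j shift_act_mult shift_act_zero_fun)
    qed
    have "f (s (real k *\<^sub>R h) x) = (\<Sum>j\<le>n. real (k choose j) * Re (?D j))" for k
    proof -
      have "complex_of_real (f (s (real k *\<^sub>R h) x)) = (\<Sum>j\<le>k. of_nat (k choose j) * ?D j)"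
        using shift_act_newton[where f = ?v and s = "s h" and k = k and x = x] by (simp add: s_funpow)
      \<comment> \<open>Either of \<open>k\<close> and \<open>n\<close> may be the larger bound:
        terms beyond \<open>k\<close> vanish by the binomial coefficient, terms beyond
        \<open>n\<close> by \<open>D0\<close>.\<close>
      also have "\<dots> = (\<Sum>j\<le>max k n. of_nat (k choose j) * ?D j)"
        by (rule sum.mono_neutral_left) (auto simp: binomial_eq_0)
      also have "\<dots> = (\<Sum>j\<le>n. of_nat (k choose j) * ?D j)"
        by (rule sum.mono_neutral_right) (auto simp: D0)
      finally have "Re (complex_of_real (f (s (real k *\<^sub>R h) x))) = Re (\<Sum>j\<le>n. of_nat (k choose j) * ?D j)"
        by simp
      then show ?thesis by simp
    qed
    then show ?thesis by (intro exI[of _ "\<lambda>j. Re (?D j)"]) blast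
  qed
  then show ?thesis by blast
qed

end

section \<open>Polynomials from finite differences\<close>

text \<open>Keeps the bound on the exponents visible, since for a distribution a single bound has to
  serve all test functions.\<close>

definition poly_fun_le :: "nat \<Rightarrow> (real^'n \<Rightarrow> real) \<Rightarrow> bool" where
  "poly_fun_le N g \<longleftrightarrow> (\<exists>c :: ('n \<Rightarrow> nat) \<Rightarrow> real.
     g = (\<lambda>x. \<Sum>\<alpha>\<in>{\<alpha>. \<forall>i. \<alpha> i \<le> N}. c \<alpha> * (\<Prod>i\<in>UNIV. (x $ i) ^ (\<alpha> i))))"

lemma poly_fun_leI:
  assumes "\<And>x. g x = (\<Sum>\<alpha>\<in>{\<alpha>. \<forall>i. \<alpha> i \<le> N}. c \<alpha> * (\<Prod>i\<in>UNIV. (x $ i) ^ (\<alpha> i)))"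
  shows "poly_fun_le N g"
  unfolding poly_fun_le_def using assms by (intro exI[of _ c] ext)

lemma poly_fun_le_imp_poly_fun: "poly_fun_le N g \<Longrightarrow> poly_fun g"
  by (auto simp: poly_fun_le_def poly_fun_def)

lemma finite_exponents: "finite {\<alpha> :: 'n::finite \<Rightarrow> nat. \<forall>i. \<alpha> i \<le> N}"
proof -
  have "{\<alpha> :: 'n \<Rightarrow> nat. \<forall>i. \<alpha> i \<le> N} = (\<Pi>\<^sub>E i\<in>UNIV. {..N})"
    by (auto simp: PiE_def)
  then show ?thesis by (simp add: finite_PiE)
qed

lemma poly_fun_le_mono:
  assumes "poly_fun_le N g" "N \<le> M"
  shows "poly_fun_le M (g :: real^'n \<Rightarrow> real)"
proof -
  obtain c :: "('n \<Rightarrow> nat) \<Rightarrow> real" where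
    c: "g = (\<lambda>x. \<Sum>\<alpha>\<in>{\<alpha>. \<forall>i. \<alpha> i \<le> N}. c \<alpha> * (\<Prod>i\<in>UNIV. (x $ i) ^ (\<alpha> i)))"
    using assms by (auto simp: poly_fun_le_def)
  have "g x = (\<Sum>\<alpha>\<in>{\<alpha>. \<forall>i. \<alpha> i \<le> M}. (if \<forall>i. \<alpha> i \<le> N then c \<alpha> else 0) * (\<Prod>i\<in>UNIV. (x $ i) ^ (\<alpha> i)))" for x
    unfolding c
    by (rule sum.mono_neutral_cong_left) (use assms in \<open>auto simp: finite_exponents intro: order_trans\<close>)
  then show ?thesis by (rule poly_fun_leI)
qed

lemma poly_fun_le_const: "poly_fun_le N (\<lambda>x. a)"
proof -
  have "a = (\<Sum>\<alpha>\<in>{\<alpha>. \<forall>i. \<alpha> i \<le> N}. (if \<alpha> = (\<lambda>_. 0) then a else 0) * (\<Prod>i\<in>UNIV. (x $ i) ^ (\<alpha> i)))" for x :: "real^'n"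
  proof -
    have "a = (\<Sum>\<alpha>\<in>{\<alpha> :: 'n \<Rightarrow> nat. \<forall>i. \<alpha> i \<le> N}. if \<alpha> = (\<lambda>_. 0) then a else 0)"
      by (simp add: finite_exponents)
    also have "\<dots> = (\<Sum>\<alpha>\<in>{\<alpha>. \<forall>i. \<alpha> i \<le> N}. (if \<alpha> = (\<lambda>_. 0) then a else 0) * (\<Prod>i\<in>UNIV. (x $ i) ^ (\<alpha> i)))"
      by (rule sum.cong) auto
    finally show ?thesis .
  qed
  then show ?thesis by (rule poly_fun_leI)
qed

lemma poly_fun_le_add:
  assumes "poly_fun_le N f" "poly_fun_le N g"
  shows "poly_fun_le N (\<lambda>x. f x + g x)"
proof -
  obtain c where c: "f = (\<lambda>x. \<Sum>\<alpha>\<in>{\<alpha>. \<forall>i. \<alpha> i \<le> N}. c \<alpha> * (\<Prod>i\<in>UNIV. (x $ i) ^ (\<alpha> i)))"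
    using assms by (auto simp: poly_fun_le_def)
  obtain d where d: "g = (\<lambda>x. \<Sum>\<alpha>\<in>{\<alpha>. \<forall>i. \<alpha> i \<le> N}. d \<alpha> * (\<Prod>i\<in>UNIV. (x $ i) ^ (\<alpha> i)))"
    using assms by (auto simp: poly_fun_le_def)
  show ?thesis unfolding poly_fun_le_def c d
    by (rule exI[of _ "\<lambda>\<alpha>. c \<alpha> + d \<alpha>"]) (simp add: algebra_simps sum.distrib)
qed

lemma poly_fun_le_cmult:
  assumes "poly_fun_le N f"
  shows "poly_fun_le N (\<lambda>x. a * f x)"
proof -
  obtain c where c: "f = (\<lambda>x. \<Sum>\<alpha>\<in>{\<alpha>. \<forall>i. \<alpha> i \<le> N}. c \<alpha> * (\<Prod>i\<in>UNIV. (x $ i) ^ (\<alpha> i)))"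
    using assms by (auto simp: poly_fun_le_def)
  show ?thesis unfolding poly_fun_le_def c
    by (rule exI[of _ "\<lambda>\<alpha>. a * c \<alpha>"]) (simp add: sum_distrib_left mult.assoc)
qed

lemma poly_fun_le_sum:
  assumes "\<And>j. j \<in> J \<Longrightarrow> poly_fun_le N (f j)"
  shows "poly_fun_le N (\<lambda>x. \<Sum>j\<in>J. f j x)"
  using assms
  by (induction J rule: infinite_finite_induct) (simp_all add: poly_fun_le_const poly_fun_le_add)

text \<open>Multiplication by a coordinate shifts the exponents through the injection
  \<open>up\<close>. Multi-indices of the larger box outside its image get coefficient 0.\<close>

lemma poly_fun_le_coord_mult:
  assumes "poly_fun_le N (f :: real^'n \<Rightarrow> real)"
  shows "poly_fun_le (Suc N) (\<lambda>x. x $ i * f x)"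
proof -
  let ?A = "{\<alpha> :: 'n \<Rightarrow> nat. \<forall>i. \<alpha> i \<le> N}" and ?B = "{\<alpha> :: 'n \<Rightarrow> nat. \<forall>i. \<alpha> i \<le> Suc N}"
  define up :: "('n \<Rightarrow> nat) \<Rightarrow> 'n \<Rightarrow> nat" where "up \<alpha> = \<alpha>(i := Suc (\<alpha> i))" for \<alpha>
  define dn :: "('n \<Rightarrow> nat) \<Rightarrow> 'n \<Rightarrow> nat" where "dn \<alpha> = \<alpha>(i := \<alpha> i - 1)" for \<alpha>
  have dn_up: "dn (up \<alpha>) = \<alpha>" for \<alpha> by (simp add: up_def dn_def)
  have inj: "inj_on up ?A" by (metis dn_up inj_onI)
  obtain c where c: "f = (\<lambda>x. \<Sum>\<alpha>\<in>?A. c \<alpha> * (\<Prod>i\<in>UNIV. (x $ i) ^ (\<alpha> i)))"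
    using assms by (auto simp: poly_fun_le_def)
  have up_prod: "x $ i * (\<Prod>j\<in>UNIV. (x $ j) ^ (\<alpha> j)) = (\<Prod>j\<in>UNIV. (x $ j) ^ (up \<alpha> j))" for x :: "real^'n" and \<alpha>
  proof -
    have "(\<Prod>j\<in>UNIV-{i}. (x $ j) ^ (up \<alpha> j)) = (\<Prod>j\<in>UNIV-{i}. (x $ j) ^ (\<alpha> j))"
      by (rule prod.cong) (auto simp: up_def)
    then show ?thesis
      using prod.remove[of UNIV i "\<lambda>j. (x $ j) ^ (\<alpha> j)"] prod.remove[of UNIV i "\<lambda>j. (x $ j) ^ (up \<alpha> j)"]
      by (simp add: up_def)
  qed
  have "x $ i * f x = (\<Sum>\<alpha>\<in>?B. (if \<alpha> \<in> up ` ?A then c (dn \<alpha>) else 0) * (\<Prod>j\<in>UNIV. (x $ j) ^ (\<alpha> j)))" for x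
  proof -
    have "x $ i * f x = (\<Sum>\<alpha>\<in>?A. c (dn (up \<alpha>)) * (\<Prod>j\<in>UNIV. (x $ j) ^ (up \<alpha> j)))"
      unfolding c by (simp add: sum_distrib_left dn_up flip: up_prod) (simp add: algebra_simps)
    also have "\<dots> = (\<Sum>\<alpha>\<in>up ` ?A. c (dn \<alpha>) * (\<Prod>j\<in>UNIV. (x $ j) ^ (\<alpha> j)))"
      by (simp add: sum.reindex[OF inj])
    also have "\<dots> = (\<Sum>\<alpha>\<in>?B. (if \<alpha> \<in> up ` ?A then c (dn \<alpha>) else 0) * (\<Prod>j\<in>UNIV. (x $ j) ^ (\<alpha> j)))"
      by (rule sum.mono_neutral_cong_left) (auto simp: finite_exponents up_def le_SucI)
    finally show ?thesis .
  qed
  then show ?thesis by (rule poly_fun_leI)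
qed

lemma poly_fun_le_poly_mult:
  assumes "poly_fun_le N f"
  shows "poly_fun_le (N + degree p) (\<lambda>x. poly p (x $ i) * f x)"
proof (induction p)
  case 0
  then show ?case by (simp add: poly_fun_le_const)
next
  case (pCons a p)
  show ?case
  proof (cases "p = 0")
    case True
    then show ?thesis using poly_fun_le_cmult[OF assms] by simp
  next
    case False
    have "poly_fun_le (N + degree (pCons a p)) (\<lambda>x. a * f x + x $ i * (poly p (x $ i) * f x))"
      using False poly_fun_le_coord_mult[OF pCons.IH, of i]
      by (intro poly_fun_le_add poly_fun_le_mono[OF poly_fun_le_cmult[OF assms]]) auto
    then show ?thesis by (simp add: algebra_simps)
  qed
qed

section \<open>Interpolation at the natural numbers\<close>

definition lagrange_basis :: "nat \<Rightarrow> nat \<Rightarrow> real poly" where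
  "lagrange_basis n j = (\<Prod>i\<in>{..n}-{j}. smult (1 / (real j - real i)) [:- real i, 1:])"

lemma degree_lagrange_basis: "j \<le> n \<Longrightarrow> degree (lagrange_basis n j) \<le> n"
proof -
  assume "j \<le> n"
  have "degree (lagrange_basis n j) \<le> (\<Sum>i\<in>{..n}-{j}. degree (smult (1 / (real j - real i)) [:- real i, 1:]))"
    unfolding lagrange_basis_def by (rule degree_prod_sum_le[unfolded comp_def]) simp
  also have "\<dots> \<le> (\<Sum>i\<in>{..n}-{j}. 1)" by (rule sum_mono) simp
  also have "\<dots> = n" using \<open>j \<le> n\<close> by simp
  finally show ?thesis .
qed

lemma poly_lagrange_basis:
  assumes "k \<le> n" "j \<le> n"
  shows "poly (lagrange_basis n j) (real k) = (if k = j then 1 else 0)"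
proof (cases "k = j")
  case True
  have "poly (smult (1 / (real j - real i)) [:- real i, 1:]) (real j) = 1" if "i \<noteq> j" for i
    using that by (simp flip: diff_divide_distrib)
  then show ?thesis using True unfolding lagrange_basis_def poly_prod
    by (simp del: poly_smult)
next
  case False
  then have "poly (smult (1 / (real j - real k)) [:- real k, 1:]) (real k) = 0" "k \<in> {..n} - {j}"
    using assms by auto
  then show ?thesis using False unfolding lagrange_basis_def poly_prod
    by (auto intro!: prod_zero)
qed

lemma poly_eq_on_nats:
  fixes p q :: "real poly"
  assumes "degree p \<le> n" "degree q \<le> n" "\<And>k. k \<le> n \<Longrightarrow> poly p (real k) = poly q (real k)"
  shows "p = q"
proof (rule ccontr)
  assume "p \<noteq> q"
  then have "card {x. poly (p - q) x = 0} \<le> degree (p - q)" "finite {x. poly (p - q) x = 0}"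
    using card_poly_roots_bound poly_roots_finite by (metis right_minus_eq)+
  moreover have "real ` {..n} \<subseteq> {x. poly (p - q) x = 0}" using assms(3) by auto
  moreover have "card (real ` {..n}) = Suc n" by (simp add: card_image)
  moreover have "degree (p - q) \<le> n" using assms degree_diff_le by blast
  ultimately show False using card_mono[of "{x. poly (p - q) x = 0}" "real ` {..n}"] by linarith
qed

lemma lagrange_interpolation:
  assumes "degree p \<le> n"
  shows "poly p t = (\<Sum>j\<le>n. poly p (real j) * poly (lagrange_basis n j) t)"
proof -
  have "p = (\<Sum>j\<le>n. smult (poly p (real j)) (lagrange_basis n j))"
  proof (rule poly_eq_on_nats[OF assms])
    show "degree (\<Sum>j\<le>n. smult (poly p (real j)) (lagrange_basis n j)) \<le> n"
      by (intro degree_sum_le) (auto intro: order_trans[OF degree_smult_le] degree_lagrange_basis)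
    show "poly p (real k) = poly (\<Sum>j\<le>n. smult (poly p (real j)) (lagrange_basis n j)) (real k)"
      if "k \<le> n" for k
    proof -
      have "poly (\<Sum>j\<le>n. smult (poly p (real j)) (lagrange_basis n j)) (real k)
          = (\<Sum>j\<le>n. if k = j then poly p (real j) else 0)"
        unfolding poly_sum using that by (intro sum.cong) (auto simp: poly_lagrange_basis)
      then show ?thesis using that by simp
    qed
  qed
  then show ?thesis by (metis (no_types, lifting) poly_smult poly_sum sum.cong)
qed

text \<open>The binomial coefficient \<open>X choose j\<close> as a polynomial in
  \<open>X\<close>.\<close>

definition newton_poly :: "nat \<Rightarrow> real poly" where
  "newton_poly j = smult (1 / fact j) (\<Prod>i<j. [:- real i, 1:])"

lemma degree_newton_poly: "degree (newton_poly j) \<le> j"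
proof -
  have "degree (\<Prod>i<j. [:- real i, 1:]) \<le> (\<Sum>i<j. degree [:- real i, 1:])"
    by (rule degree_prod_sum_le[unfolded comp_def]) simp
  then show ?thesis by (simp add: newton_poly_def)
qed

lemma poly_newton_poly: "poly (newton_poly j) (real k) = real (k choose j)"
proof -
  have "poly (newton_poly j) (real k) = real k gchoose j"
    by (simp add: newton_poly_def poly_prod gbinomial_prod_rev atLeast0LessThan)
  then show ?thesis by (simp add: binomial_gbinomial)
qed

text \<open>For each mesh \<open>1 / (q + 1)\<close> the Newton expansion gives a polynomial of
  degree at most \<open>n\<close> that agrees with \<open>g\<close> on the nonnegative multiples of
  the mesh. All these polynomials agree at the natural numbers and hence coincide; continuity then
  passes from nonnegative rationals to reals.\<close>

lemma newton_nonneg_poly: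
  fixes g :: "real \<Rightarrow> real"
  assumes cont: "continuous_on UNIV g"
    and newton: "\<And>h. \<exists>d. \<forall>k. g (real k * h) = (\<Sum>j\<le>n. real (k choose j) * d j)"
  shows "\<exists>p. degree p \<le> n \<and> (\<forall>t\<ge>0. g t = poly p t)"
proof -
  have "\<exists>p. degree p \<le> n \<and> (\<forall>k. g (real k / real (Suc q)) = poly p (real k / real (Suc q)))" for q
  proof -
    obtain d where d: "\<And>k. g (real k * (1 / real (Suc q))) = (\<Sum>j\<le>n. real (k choose j) * d j)"
      using newton by blast
    define p where "p = (\<Sum>j\<le>n. smult (d j) (newton_poly j))"
    have deg: "degree p \<le> n"
      unfolding p_def by (intro degree_sum_le) (auto intro: order_trans[OF degree_smult_le] order_trans[OF degree_newton_poly])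
    have p: "poly p (real k) = g (real k / real (Suc q))" for k
      using d[of k] by (simp add: p_def poly_sum poly_newton_poly mult.commute)
    \<comment> \<open>The argument of \<open>p\<close> is the number of steps, so the composition
      rescales it to the position on the line.\<close>
    have "degree (pcompose p [:0, real (Suc q):]) \<le> n"
      using deg degree_pcompose[of p "[:0, real (Suc q):]"] by (simp del: of_nat_Suc)
    moreover have "g (real k / real (Suc q)) = poly (pcompose p [:0, real (Suc q):]) (real k / real (Suc q))" for k
      using p[of k] by (simp add: poly_pcompose del: of_nat_Suc)
    ultimately show ?thesis by blast
  qed
  then obtain p where p: "\<And>q. degree (p q) \<le> n" "\<And>q k. g (real k / real (Suc q)) = poly (p q) (real k / real (Suc q))"
    by metis
  have nat: "poly (p q) (real k) = g (real k)" for q k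
    using p(2)[of "k * Suc q" q] by (simp only: of_nat_mult) (simp del: of_nat_Suc)
  have pq: "p q = p 0" for q
    by (rule poly_eq_on_nats[OF p(1) p(1)]) (simp add: nat)
  have rat: "g r = poly (p 0) r" if r: "r \<in> \<rat>" "r \<ge> 0" for r
  proof -
    obtain k m where km: "m \<noteq> 0" "\<bar>r\<bar> = real k / real m" "coprime k m"
      using Rats_abs_nat_div_natE[OF r(1)] by blast
    then obtain q where "m = Suc q" using not0_implies_Suc by blast
    then show ?thesis using km p(2)[of k q] pq[of q] r(2) by simp
  qed
  have "g t = poly (p 0) t" if t: "t \<ge> 0" for t
  proof (rule ccontr)
    assume ne: "g t \<noteq> poly (p 0) t"
    have "open {x. g x \<noteq> poly (p 0) x}"
      by (intro open_Collect_neq cont continuous_intros)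
    then obtain e where e: "e > 0" "\<And>y. dist y t < e \<Longrightarrow> g y \<noteq> poly (p 0) y"
      using ne unfolding open_dist by auto
    \<comment> \<open>The rational is taken to the right of \<open>t\<close> so that it is
      nonnegative even when \<open>t = 0\<close>.\<close>
    obtain r where "r \<in> \<rat>" "t < r" "r < t + e" using Rats_dense_in_real[of t "t + e"] e by auto
    then show False using e(2)[of r] rat[of r] t by (auto simp: dist_real_def)
  qed
  then show ?thesis using p(1) by blast
qed

text \<open>Formulated with fixed nodes and fixed weights, so that it can be applied to one
  coordinate at a time while the others vary.\<close>

lemma newton_lagrange:
  fixes g :: "real \<Rightarrow> real"
  assumes cont: "continuous_on UNIV g"
    and newton: "\<And>x h. \<exists>d. \<forall>k. g (x + real k * h) = (\<Sum>j\<le>n. real (k choose j) * d j)"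
  shows "g t = (\<Sum>j\<le>n. g (real j) * poly (lagrange_basis n j) t)"
proof -
  \<comment> \<open>Starting the half-line at \<open>min t 0\<close> puts \<open>t\<close> and all
    interpolation nodes on it.\<close>
  define x where "x = min t 0"
  have "continuous_on UNIV (\<lambda>u. g (x + u))"
    by (intro continuous_on_compose2[OF cont] continuous_intros) auto
  then obtain p where p: "degree p \<le> n" "\<And>u. u \<ge> 0 \<Longrightarrow> g (x + u) = poly p u"
    using newton_nonneg_poly[of "\<lambda>u. g (x + u)" n] newton by blast
  define q where "q = pcompose p [:- x, 1:]"
  have "degree q \<le> n" using p(1) degree_pcompose[of p "[:- x, 1:]"] by (simp add: q_def)
  moreover have q: "g u = poly q u" if "u \<ge> x" for u
    using p(2)[of "u - x"] that by (simp add: q_def poly_pcompose)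
  moreover have "x \<le> real j" for j by (simp add: x_def min_def)
  ultimately show ?thesis using lagrange_interpolation[of q n t] by (simp add: x_def)
qed

section \<open>Passage from one variable to several\<close>

text \<open>Induction on a set of coordinates that determine \<open>F\<close>. Adding
  \<open>(real j - x $ i) *\<^sub>R axis i 1\<close> overwrites coordinate \<open>i\<close> by
  \<open>j\<close>, so interpolation in that coordinate leaves coefficient functions determined by
  the remaining ones. Each step costs \<open>n\<close> in the exponent bound.\<close>

lemma separately_poly_imp_poly_fun_le:
  fixes F :: "real^'n \<Rightarrow> real"
  assumes "finite S"
    and "\<And>x i. F x = (\<Sum>j\<le>n. F (x + (real j - x $ i) *\<^sub>R axis i 1) * poly (lagrange_basis n j) (x $ i))"
    and "\<And>x y. (\<forall>i\<in>S. x $ i = y $ i) \<Longrightarrow> F x = F y"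
  shows "poly_fun_le (n * card S) F"
  using assms
proof (induction S arbitrary: F rule: finite_induct)
  case empty
  have "F = (\<lambda>x. F 0)" using empty(2) by blast
  then show ?case using poly_fun_le_const by metis
next
  case (insert i S)
  let ?u = "\<lambda>j (x::real^'n). x + (real j - x $ i) *\<^sub>R axis i 1"
  have u_nth: "?u j x $ k = (if k = i then real j else x $ k)" for j x k
    by (simp add: axis_def)
  have "poly_fun_le (n * card S) (\<lambda>x. F (?u j x))" for j
  proof (rule insert.IH)
    fix x :: "real^'n" and k
    show "F (?u j x) = (\<Sum>m\<le>n. F (?u j (x + (real m - x $ k) *\<^sub>R axis k 1)) * poly (lagrange_basis n m) (x $ k))"
    proof (cases "k = i")
      case True
      have *: "?u j (x + (real m - x $ k) *\<^sub>R axis k 1) = ?u j x" for m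
        by (simp add: vec_eq_iff True axis_def)
      \<comment> \<open>The function does not vary with coordinate \<open>i\<close> any more;
        interpolating the constant 1 shows that the weights sum to 1.\<close>
      have "poly [:1:] (x $ k) = (\<Sum>m\<le>n. poly [:1:] (real m) * poly (lagrange_basis n m) (x $ k))"
        by (rule lagrange_interpolation) simp
      then show ?thesis unfolding * by (simp flip: sum_distrib_left)
    next
      case False
      have *: "?u j (x + (real m - x $ k) *\<^sub>R axis k 1) = ?u j x + (real m - ?u j x $ k) *\<^sub>R axis k 1" for m
        using False by (auto simp: vec_eq_iff axis_def)
      have "axis i (1::real) $ k = 0" using False by (simp add: axis_def)
      then show ?thesis using insert.prems(1)[of "?u j x" k] unfolding * by simp
    qed
  next
    fix x y :: "real^'n"
    assume xy: "\<forall>k\<in>S. x $ k = y $ k"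
    show "F (?u j x) = F (?u j y)"
    proof (intro insert.prems(2) ballI)
      fix k assume "k \<in> insert i S"
      then show "?u j x $ k = ?u j y $ k" unfolding u_nth using xy by auto
    qed
  qed
  then have "poly_fun_le (n * card S + degree (lagrange_basis n j)) (\<lambda>x. poly (lagrange_basis n j) (x $ i) * F (?u j x))" for j
    by (rule poly_fun_le_poly_mult)
  then have "poly_fun_le (n * card S + n) (\<lambda>x. poly (lagrange_basis n j) (x $ i) * F (?u j x))" if "j \<le> n" for j
    by (rule poly_fun_le_mono) (use that degree_lagrange_basis in auto)
  then have "poly_fun_le (n * card S + n) (\<lambda>x. \<Sum>j\<le>n. poly (lagrange_basis n j) (x $ i) * F (?u j x))"
    by (intro poly_fun_le_sum) auto
  moreover have "F = (\<lambda>x. \<Sum>j\<le>n. poly (lagrange_basis n j) (x $ i) * F (?u j x))"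
    by (rule ext, rule trans[OF insert.prems(1)[of _ i]], rule sum.cong) (simp_all only: mult.commute)
  ultimately have "poly_fun_le (n * card S + n) F" by simp
  then show ?case using insert.hyps by (simp add: algebra_simps)
qed

text \<open>Along lines parallel to the axes, the hypothesis yields the interpolation formula in
  each coordinate through \<open>newton_lagrange\<close>; the induction then runs over all
  \<open>CARD('n)\<close> coordinates.\<close>

theorem newton_imp_poly_fun_le:
  fixes F :: "real^'n \<Rightarrow> real"
  assumes cont: "continuous_on UNIV F"
    and newton: "\<And>x h. \<exists>d. \<forall>k. F (x + real k *\<^sub>R h) = (\<Sum>j\<le>n. real (k choose j) * d j)"
  shows "poly_fun_le (n * CARD('n)) F"
proof (rule separately_poly_imp_poly_fun_le)
  fix x :: "real^'n" and i
  let ?g = "\<lambda>t. F (x + (t - x $ i) *\<^sub>R axis i 1)"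
  have "?g (x $ i) = (\<Sum>j\<le>n. ?g (real j) * poly (lagrange_basis n j) (x $ i))"
  proof (rule newton_lagrange)
    show "continuous_on UNIV ?g"
      by (intro continuous_on_compose2[OF cont] continuous_intros) auto
    fix y h :: real
    have "x + ((y + real k * h) - x $ i) *\<^sub>R axis i 1
        = (x + (y - x $ i) *\<^sub>R axis i 1) + real k *\<^sub>R (h *\<^sub>R axis i 1)" for k
      by (simp add: algebra_simps)
    then show "\<exists>d. \<forall>k. ?g (y + real k * h) = (\<Sum>j\<le>n. real (k choose j) * d j)"
      using newton[of "x + (y - x $ i) *\<^sub>R axis i 1" "h *\<^sub>R axis i 1"] by (simp only:)
  qed
  then show "F x = (\<Sum>j\<le>n. F (x + (real j - x $ i) *\<^sub>R axis i 1) * poly (lagrange_basis n j) (x $ i))"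
    by simp
next
  fix x y :: "real^'n"
  assume "\<forall>i\<in>UNIV. x $ i = y $ i"
  then have "x = y" by (simp add: vec_eq_iff)
  then show "F x = F y" by simp
qed simp

section \<open>Smooth functions and test functions\<close>

text \<open>Coinduction for \<open>smooth_fun\<close>: first-order facts suffice once a class is
  stable under \<open>partial\<close>. Most closure properties below are obtained by a suitable
  choice of \<open>C\<close>.\<close>

lemma smooth_fun_coinduct:
  assumes "C \<phi>"
    and "\<And>f. C f \<Longrightarrow> continuous_on UNIV f"
    and "\<And>f i x. C f \<Longrightarrow> (\<lambda>t. f (x + t *\<^sub>R axis i 1)) differentiable (at 0)"
    and "\<And>f i. C f \<Longrightarrow> C (partial i f)"
  shows "smooth_fun \<phi>"
proof -
  have "C (pds is \<phi>)" for "is" by (induction "is") (use assms in auto)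
  then show ?thesis unfolding smooth_fun_def using assms(2,3) by blast
qed

lemma pds_append: "pds (is @ js) \<phi> = pds is (pds js \<phi>)"
  by (induction "is") auto

lemma smooth_fun_pds: "smooth_fun \<phi> \<Longrightarrow> smooth_fun (pds is \<phi>)"
  unfolding smooth_fun_def by (metis pds_append)

lemma smooth_fun_partial: "smooth_fun \<phi> \<Longrightarrow> smooth_fun (partial i \<phi>)"
  using smooth_fun_pds[of \<phi> "[i]"] by simp

lemma smooth_fun_continuous_on: "smooth_fun \<phi> \<Longrightarrow> continuous_on S \<phi>"
  unfolding smooth_fun_def by (metis continuous_on_subset pds.simps(1) subset_UNIV)

lemma partial_eqI:
  "((\<lambda>t. \<phi> (x + t *\<^sub>R axis i 1)) has_real_derivative D) (at 0) \<Longrightarrow> partial i \<phi> x = D"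
  unfolding partial_def by (rule DERIV_imp_deriv)

lemma smooth_fun_has_partial_at_0:
  assumes "smooth_fun \<phi>"
  shows "((\<lambda>t. \<phi> (x + t *\<^sub>R axis i 1)) has_real_derivative partial i \<phi> x) (at 0)"
proof -
  have "(\<lambda>t. pds [] \<phi> (x + t *\<^sub>R axis i 1)) differentiable (at 0)"
    using assms unfolding smooth_fun_def by blast
  then show ?thesis unfolding partial_def
    by (simp add: DERIV_deriv_iff_real_differentiable)
qed

lemma smooth_fun_has_partial:
  assumes "smooth_fun \<phi>"
  shows "((\<lambda>t. \<phi> (x + t *\<^sub>R axis i 1)) has_real_derivative partial i \<phi> (x + u *\<^sub>R axis i 1)) (at u)"
proof -
  have "((\<lambda>t. \<phi> (x + u *\<^sub>R axis i 1 + t *\<^sub>R axis i 1)) has_real_derivative partial i \<phi> (x + u *\<^sub>R axis i 1)) (at 0)"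
    by (rule smooth_fun_has_partial_at_0[OF assms])
  then have "((\<lambda>t. \<phi> (x + (t + u) *\<^sub>R axis i 1)) has_real_derivative partial i \<phi> (x + u *\<^sub>R axis i 1)) (at 0)"
    by (simp add: algebra_simps)
  then show ?thesis using DERIV_shift[of "\<lambda>t. \<phi> (x + t *\<^sub>R axis i 1)" _ 0 u] by simp
qed

lemma smooth_fun_lincomb:
  assumes "smooth_fun \<phi>" "smooth_fun \<psi>"
  shows "smooth_fun (\<lambda>x. a * \<phi> x + b * \<psi> x)"
proof (rule smooth_fun_coinduct[where C = "\<lambda>f. \<exists>\<phi> \<psi>. smooth_fun \<phi> \<and> smooth_fun \<psi> \<and> f = (\<lambda>x. a * \<phi> x + b * \<psi> x)"])
  show "\<exists>\<phi>' \<psi>'. smooth_fun \<phi>' \<and> smooth_fun \<psi>' \<and> (\<lambda>x. a * \<phi> x + b * \<psi> x) = (\<lambda>x. a * \<phi>' x + b * \<psi>' x)"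
    using assms by blast
next
  fix f assume "\<exists>\<phi> \<psi>. smooth_fun \<phi> \<and> smooth_fun \<psi> \<and> f = (\<lambda>x. a * \<phi> x + b * \<psi> x)"
  then obtain \<phi> \<psi> where *: "smooth_fun \<phi>" "smooth_fun \<psi>" "f = (\<lambda>x. a * \<phi> x + b * \<psi> x)" by blast
  show "continuous_on UNIV f"
    unfolding * by (intro continuous_intros smooth_fun_continuous_on *)
  have D: "((\<lambda>t. f (x + t *\<^sub>R axis i 1)) has_real_derivative a * partial i \<phi> x + b * partial i \<psi> x) (at 0)" for i x
    unfolding * by (intro DERIV_add DERIV_cmult smooth_fun_has_partial_at_0 *)
  show "(\<lambda>t. f (x + t *\<^sub>R axis i 1)) differentiable (at 0)" for i x
    using D real_differentiable_def by blast
  have "partial i f = (\<lambda>x. a * partial i \<phi> x + b * partial i \<psi> x)" for i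
    by (rule ext) (rule partial_eqI[OF D])
  then show "\<exists>\<phi> \<psi>. smooth_fun \<phi> \<and> smooth_fun \<psi> \<and> partial i f = (\<lambda>x. a * \<phi> x + b * \<psi> x)" for i
    using smooth_fun_partial * by blast
qed

lemma partial_lincomb:
  assumes "smooth_fun \<phi>" "smooth_fun \<psi>"
  shows "partial i (\<lambda>x. a * \<phi> x + b * \<psi> x) = (\<lambda>x. a * partial i \<phi> x + b * partial i \<psi> x)"
  by (rule ext, rule partial_eqI) (intro DERIV_add DERIV_cmult smooth_fun_has_partial_at_0 assms)

lemma pds_lincomb:
  assumes "smooth_fun \<phi>" "smooth_fun \<psi>"
  shows "pds is (\<lambda>x. a * \<phi> x + b * \<psi> x) = (\<lambda>x. a * pds is \<phi> x + b * pds is \<psi> x)"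
  by (induction "is") (simp_all add: partial_lincomb smooth_fun_pds assms)

lemma partial_const: "partial i (\<lambda>x. c) = (\<lambda>x. 0)"
  by (rule ext, rule partial_eqI) simp

lemma smooth_fun_const: "smooth_fun (\<lambda>x. c)"
  by (rule smooth_fun_coinduct[where C = "\<lambda>f. \<exists>c. f = (\<lambda>x. c)"]) (auto simp: partial_const)

lemma pds_zero: "pds is (\<lambda>x. 0) = (\<lambda>x. 0)"
  by (induction "is") (simp_all add: partial_const)

lemma smooth_fun_sum:
  assumes "\<And>j. j \<in> J \<Longrightarrow> smooth_fun (f j)"
  shows "smooth_fun (\<lambda>x. \<Sum>j\<in>J. c j * f j x)"
  using assms
proof (induction J rule: infinite_finite_induct)
  case (insert j J)
  have "smooth_fun (\<lambda>x. c j * f j x + 1 * (\<Sum>j\<in>J. c j * f j x))"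
    by (rule smooth_fun_lincomb) (use insert in auto)
  then show ?case using insert.hyps by simp
qed (simp_all add: smooth_fun_const)

lemma pds_sum:
  assumes "\<And>j. j \<in> J \<Longrightarrow> smooth_fun (f j)"
  shows "pds is (\<lambda>x. \<Sum>j\<in>J. c j * f j x) = (\<lambda>x. \<Sum>j\<in>J. c j * pds is (f j) x)"
  using assms
proof (induction J rule: infinite_finite_induct)
  case (insert j J)
  have "pds is (\<lambda>x. c j * f j x + 1 * (\<Sum>j\<in>J. c j * f j x)) = (\<lambda>x. c j * pds is (f j) x + 1 * pds is (\<lambda>x. \<Sum>j\<in>J. c j * f j x) x)"
    by (rule pds_lincomb) (use insert in \<open>auto intro: smooth_fun_sum\<close>)
  then show ?case using insert by simp
qed (simp_all add: pds_zero)

text \<open>Differentiating a product leads to a sum of products, so the class used for coinduction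
  in \<open>smooth_fun_mult\<close> has to contain finite sums; it is then stable by the Leibniz
  rule.\<close>

inductive product_span :: "(real^'n \<Rightarrow> real) \<Rightarrow> bool" where
  product: "smooth_fun f \<Longrightarrow> smooth_fun g \<Longrightarrow> product_span (\<lambda>x. f x * g x)"
| add: "product_span f \<Longrightarrow> product_span g \<Longrightarrow> product_span (\<lambda>x. f x + g x)"

lemma product_span_partial:
  assumes "product_span f"
  shows "\<exists>g. product_span g \<and> (\<forall>x. ((\<lambda>t. f (x + t *\<^sub>R axis i 1)) has_real_derivative g x) (at 0))"
  using assms
proof induction
  case (product f g)
  have "((\<lambda>t. f (x + t *\<^sub>R axis i 1) * g (x + t *\<^sub>R axis i 1)) has_real_derivative
      partial i f x * g x + f x * partial i g x) (at 0)" for x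
    using DERIV_mult[OF smooth_fun_has_partial_at_0[OF product(1), of x i] smooth_fun_has_partial_at_0[OF product(2), of x i]]
    by (simp add: algebra_simps)
  moreover have "product_span (\<lambda>x. partial i f x * g x + f x * partial i g x)"
    by (intro product_span.intros product smooth_fun_partial)
  ultimately show ?case by blast
next
  case (add f g)
  then obtain f' g' where "product_span f'" "product_span g'"
    "\<forall>x. ((\<lambda>t. f (x + t *\<^sub>R axis i 1)) has_real_derivative f' x) (at 0)"
    "\<forall>x. ((\<lambda>t. g (x + t *\<^sub>R axis i 1)) has_real_derivative g' x) (at 0)" by blast
  then show ?case
    by (intro exI[of _ "\<lambda>x. f' x + g' x"] conjI product_span.add allI DERIV_add) auto
qed

lemma smooth_fun_mult:
  assumes "smooth_fun f" "smooth_fun g"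
  shows "smooth_fun (\<lambda>x. f x * g x)"
proof (rule smooth_fun_coinduct[where C = product_span])
  show "product_span (\<lambda>x. f x * g x)" by (intro product_span.product assms)
next
  fix h :: "real^'a \<Rightarrow> real" assume h: "product_span h"
  then show "continuous_on UNIV h"
    by induction (auto intro!: continuous_on_mult continuous_on_add dest: smooth_fun_continuous_on)
  fix i
  obtain g where g: "product_span g" "\<And>x. ((\<lambda>t. h (x + t *\<^sub>R axis i 1)) has_real_derivative g x) (at 0)"
    using product_span_partial[OF h] by blast
  show "(\<lambda>t. h (x + t *\<^sub>R axis i 1)) differentiable (at 0)" for x
    using g(2) real_differentiable_def by blast
  have "partial i h = g" by (rule ext) (rule partial_eqI[OF g(2)])
  then show "product_span (partial i h)" using g(1) by simp
qed

lemma smooth_fun_coord: "smooth_fun (\<lambda>x::real^'n. x $ k)"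
proof (rule smooth_fun_coinduct[where C = "\<lambda>f. f = (\<lambda>x. x $ k) \<or> (\<exists>c. f = (\<lambda>x. c))"])
  fix f :: "real^'n \<Rightarrow> real" assume f: "f = (\<lambda>x. x $ k) \<or> (\<exists>c. f = (\<lambda>x. c))"
  then show "continuous_on UNIV f" by (auto intro!: continuous_intros)
  have D: "((\<lambda>t. (x + t *\<^sub>R axis i 1) $ k) has_real_derivative axis i 1 $ k) (at 0)" for x :: "real^'n" and i
    by (auto intro!: derivative_eq_intros)
  then have "(\<lambda>t. (x + t *\<^sub>R axis i 1) $ k) differentiable (at 0)" for x :: "real^'n" and i
    using real_differentiable_def by blast
  then show "(\<lambda>t. f (x + t *\<^sub>R axis i 1)) differentiable (at 0)" for i x using f by auto
  have "partial i (\<lambda>x. x $ k) = (\<lambda>x. axis i 1 $ k)" for i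
    by (rule ext) (rule partial_eqI[OF D])
  then show "partial i f = (\<lambda>x. x $ k) \<or> (\<exists>c. partial i f = (\<lambda>x. c))" for i
    using f by (auto simp: partial_const)
qed simp

lemma smooth_fun_power: "smooth_fun f \<Longrightarrow> smooth_fun (\<lambda>x. f x ^ m)"
  by (induction m) (simp_all add: smooth_fun_const smooth_fun_mult)

lemma smooth_fun_prod:
  "(\<And>j. j \<in> J \<Longrightarrow> smooth_fun (f j)) \<Longrightarrow> smooth_fun (\<lambda>x. \<Prod>j\<in>J. f j x)"
  by (induction J rule: infinite_finite_induct) (simp_all add: smooth_fun_const smooth_fun_mult)

lemma poly_fun_smooth: "poly_fun p \<Longrightarrow> smooth_fun p"
  unfolding poly_fun_def
  by (auto intro!: smooth_fun_sum smooth_fun_prod smooth_fun_power smooth_fun_coord)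

section \<open>Total differentiability and linear substitutions\<close>

text \<open>Continuity of the partial derivatives gives total differentiability. \<open>S\<close>
  collects the coordinates already moved; a new one adds an error controlled by the mean value
  inequality, and \<open>e\<close> is halved between the old error and the new one.\<close>

lemma smooth_fun_has_derivative_aux:
  fixes f :: "real^'n \<Rightarrow> real"
  assumes f: "smooth_fun f" and "finite S" "e > 0"
  shows "\<exists>d>0. \<forall>v. norm v < d \<longrightarrow>
    \<bar>f (x + (\<chi> i. if i \<in> S then v $ i else 0)) - f x - (\<Sum>i\<in>S. v $ i * partial i f x)\<bar> \<le> e * norm v"
  using assms(2,3)
proof (induction S arbitrary: e rule: finite_induct)
  case empty
  have "x + (\<chi> i. 0) = x" by (simp add: vec_eq_iff)
  then show ?case using empty by (intro exI[of _ 1]) simp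
next
  case (insert i S)
  obtain d1 where d1: "d1 > 0" "\<And>v. norm v < d1 \<Longrightarrow>
    \<bar>f (x + (\<chi> i. if i \<in> S then v $ i else 0)) - f x - (\<Sum>i\<in>S. v $ i * partial i f x)\<bar> \<le> e / 2 * norm v"
    using insert.IH[of "e / 2"] insert.prems by auto
  have "isCont (partial i f) x"
    using smooth_fun_continuous_on[OF smooth_fun_partial[OF f], of UNIV] continuous_on_eq_continuous_at by blast
  then obtain d2 where d2: "d2 > 0" "\<And>y. dist y x < d2 \<Longrightarrow> dist (partial i f y) (partial i f x) < e / 2"
    unfolding continuous_at_eps_delta using insert.prems by (metis half_gt_zero)
  show ?case
  proof (intro exI[of _ "min d1 d2"] conjI allI impI)
    show "min d1 d2 > 0" using d1 d2 by simp
    fix v :: "real^'n" assume v: "norm v < min d1 d2"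
    define w where "w = (\<chi> i. if i \<in> S then v $ i else 0)"
    have w': "(\<chi> k. if k \<in> insert i S then v $ k else 0) = w + (v $ i) *\<^sub>R axis i 1"
      using insert.hyps by (auto simp: w_def vec_eq_iff axis_def)
    have sum_insert: "(\<Sum>k\<in>insert i S. v $ k * partial k f x) = v $ i * partial i f x + (\<Sum>k\<in>S. v $ k * partial k f x)"
      using insert.hyps by simp
    \<comment> \<open>With the linear term subtracted, the derivative is a difference of two values
      of \<open>partial i f\<close>, at most \<open>e / 2\<close> near \<open>x\<close> by
      continuity.\<close>
    let ?g = "\<lambda>t. f (x + w + t *\<^sub>R axis i 1) - t * partial i f x"
    have "norm (?g (v $ i) - ?g 0) \<le> e / 2 * norm (v $ i - 0)"
    proof (rule field_differentiable_bound)
      show "convex (closed_segment 0 (v $ i))" by simp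
      show "(?g has_real_derivative partial i f (x + w + t *\<^sub>R axis i 1) - partial i f x)
          (at t within closed_segment 0 (v $ i))" for t
        using DERIV_subset[OF smooth_fun_has_partial[OF f, of "x + w" i t]]
        by (auto intro!: derivative_eq_intros)
      show "norm (partial i f (x + w + t *\<^sub>R axis i 1) - partial i f x) \<le> e / 2"
        if t: "t \<in> closed_segment 0 (v $ i)" for t
      proof -
        have "\<bar>t\<bar> \<le> \<bar>v $ i\<bar>" using t by (auto simp: closed_segment_eq_real_ivl split: if_splits)
        then have "norm (w + t *\<^sub>R axis i 1) \<le> norm v"
          using insert.hyps by (intro norm_le_componentwise_cart) (auto simp: w_def axis_def)
        then have "dist (x + w + t *\<^sub>R axis i 1) x < d2" using v by (simp add: dist_norm add.assoc)
        then show ?thesis using d2(2) by (simp add: dist_norm less_imp_le)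
      qed
    qed auto
    then have 1: "\<bar>f (x + w + (v $ i) *\<^sub>R axis i 1) - f (x + w) - v $ i * partial i f x\<bar> \<le> e / 2 * \<bar>v $ i\<bar>"
      by (simp add: algebra_simps)
    have "e / 2 * \<bar>v $ i\<bar> \<le> e / 2 * norm v"
      using insert.prems component_le_norm_cart[of v i] by (intro mult_left_mono) auto
    moreover have "\<bar>f (x + w) - f x - (\<Sum>i\<in>S. v $ i * partial i f x)\<bar> \<le> e / 2 * norm v"
      using d1(2)[of v] v by (simp add: w_def)
    ultimately show "\<bar>f (x + (\<chi> k. if k \<in> insert i S then v $ k else 0)) - f x - (\<Sum>k\<in>insert i S. v $ k * partial k f x)\<bar> \<le> e * norm v"
      using 1 unfolding w' sum_insert add.assoc[symmetric] by linarith
  qed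
qed

lemma smooth_fun_has_derivative:
  fixes f :: "real^'n \<Rightarrow> real"
  assumes "smooth_fun f"
  shows "(f has_derivative (\<lambda>v. \<Sum>i\<in>UNIV. v $ i * partial i f x)) (at x)"
  unfolding has_derivative_at_alt
proof (intro conjI allI impI)
  show "bounded_linear (\<lambda>v. \<Sum>i\<in>UNIV. v $ i * partial i f x)"
    by (intro bounded_linear_sum bounded_linear_mult_left bounded_linear_compose[OF bounded_linear_mult_left bounded_linear_vec_nth])
  fix e :: real assume "e > 0"
  obtain d where d: "d > 0" "\<And>v. norm v < d \<Longrightarrow>
    \<bar>f (x + (\<chi> i. if i \<in> UNIV then v $ i else 0)) - f x - (\<Sum>i\<in>UNIV. v $ i * partial i f x)\<bar> \<le> e * norm v"
    using smooth_fun_has_derivative_aux[OF assms finite[of UNIV] \<open>e > 0\<close>] by blast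
  show "\<exists>d>0. \<forall>y. norm (y - x) < d \<longrightarrow> norm (f y - f x - (\<Sum>i\<in>UNIV. (y - x) $ i * partial i f x)) \<le> e * norm (y - x)"
  proof (intro exI[of _ d] conjI allI impI d(1))
    fix y assume "norm (y - x) < d"
    moreover have "x + (\<chi> i. if i \<in> UNIV then (y - x) $ i else 0) = y" by (simp add: vec_eq_iff)
    ultimately show "norm (f y - f x - (\<Sum>i\<in>UNIV. (y - x) $ i * partial i f x)) \<le> e * norm (y - x)"
      using d(2)[of "y - x"] by simp
  qed
qed

text \<open>By the chain rule, a partial derivative of the composition is again a composition with
  \<open>P\<close>, namely of a constant-coefficient combination of partial derivatives of
  \<open>\<phi>\<close>. The chain rule rests on the total derivative.\<close>

lemma smooth_fun_compose_linear:
  fixes P :: "real^'n^'n"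
  assumes "smooth_fun \<phi>"
  shows "smooth_fun (\<lambda>x. \<phi> (P *v x))"
proof (rule smooth_fun_coinduct[where C = "\<lambda>f. \<exists>\<phi>. smooth_fun \<phi> \<and> f = (\<lambda>x. \<phi> (P *v x))"])
  show "\<exists>\<phi>'. smooth_fun \<phi>' \<and> (\<lambda>x. \<phi> (P *v x)) = (\<lambda>x. \<phi>' (P *v x))" using assms by blast
next
  fix f assume "\<exists>\<phi>. smooth_fun \<phi> \<and> f = (\<lambda>x. \<phi> (P *v x))"
  then obtain \<phi> where \<phi>: "smooth_fun \<phi>" "f = (\<lambda>x. \<phi> (P *v x))" by blast
  show "continuous_on UNIV f" unfolding \<phi>(2)
    by (rule continuous_on_compose2[OF smooth_fun_continuous_on[OF \<phi>(1)]]) (auto intro!: continuous_intros)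
  have D: "((\<lambda>t. f (x + t *\<^sub>R axis i 1)) has_real_derivative
      (\<Sum>j\<in>UNIV. (P *v axis i 1) $ j * partial j \<phi> (P *v x))) (at 0)" for i x
  proof -
    have "((\<lambda>t::real. P *v x + t *\<^sub>R (P *v axis i 1)) has_derivative (\<lambda>t. t *\<^sub>R (P *v axis i 1))) (at 0)"
      by (auto intro!: derivative_eq_intros)
    from has_derivative_compose[OF this smooth_fun_has_derivative[OF \<phi>(1)]]
    have "((\<lambda>t. \<phi> (P *v x + t *\<^sub>R (P *v axis i 1))) has_derivative
        (\<lambda>t. \<Sum>j\<in>UNIV. (t *\<^sub>R (P *v axis i 1)) $ j * partial j \<phi> (P *v x))) (at 0)" by simp
    moreover have "(\<lambda>t. \<Sum>j\<in>UNIV. (t *\<^sub>R (P *v axis i 1)) $ j * partial j \<phi> (P *v x))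
        = (*) (\<Sum>j\<in>UNIV. (P *v axis i 1) $ j * partial j \<phi> (P *v x))"
      by (rule ext) (simp add: sum_distrib_left algebra_simps)
    ultimately show ?thesis unfolding \<phi>(2) has_field_derivative_def
      by (simp add: matrix_vector_right_distrib matrix_vector_mult_scaleR)
  qed
  show "(\<lambda>t. f (x + t *\<^sub>R axis i 1)) differentiable (at 0)" for i x
    using D real_differentiable_def by blast
  have "partial i f = (\<lambda>x. (\<lambda>y. \<Sum>j\<in>UNIV. (P *v axis i 1) $ j * partial j \<phi> y) (P *v x))" for i
    by (rule ext) (simp add: partial_eqI[OF D])
  moreover have "smooth_fun (\<lambda>y. \<Sum>j\<in>UNIV. (P *v axis i 1) $ j * partial j \<phi> y)" for i
    by (intro smooth_fun_sum smooth_fun_partial \<phi>)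
  ultimately show "\<exists>\<phi>. smooth_fun \<phi> \<and> partial i f = (\<lambda>x. \<phi> (P *v x))" for i by blast
qed

lemma pds_shift: "pds is (\<lambda>x. \<phi> (x - h)) = (\<lambda>x. pds is \<phi> (x - h))"
proof (induction "is")
  case (Cons i "is")
  have "partial i (\<lambda>x. f (x - h)) = (\<lambda>x. partial i f (x - h))" for f :: "real^'a \<Rightarrow> real"
    by (simp add: partial_def algebra_simps)
  then show ?case using Cons by simp
qed simp

lemma smooth_fun_shift:
  assumes "smooth_fun \<phi>"
  shows "smooth_fun (\<lambda>x. \<phi> (x - h))"
  unfolding smooth_fun_def pds_shift
proof (intro allI conjI)
  fix "is" i x
  show "continuous_on UNIV (\<lambda>x. pds is \<phi> (x - h))"
    by (rule continuous_on_compose2[OF smooth_fun_continuous_on[OF smooth_fun_pds[OF assms]]])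
      (auto intro!: continuous_intros)
  have "(\<lambda>t. pds is \<phi> ((x - h) + t *\<^sub>R axis i 1)) differentiable (at 0)"
    using assms unfolding smooth_fun_def by blast
  then show "(\<lambda>t. pds is \<phi> (x + t *\<^sub>R axis i 1 - h)) differentiable (at 0)"
    by (simp add: algebra_simps)
qed

section \<open>Test functions\<close>

lemma compact_closure_support_iff:
  "compact (closure {x. \<phi> x \<noteq> 0}) \<longleftrightarrow> bounded {x::real^'n. \<phi> x \<noteq> 0}"
  by (metis bounded_closure bounded_subset closed_closure closure_subset compact_eq_bounded_closed)

lemma test_fun_iff: "test_fun \<phi> \<longleftrightarrow> smooth_fun \<phi> \<and> bounded {x. \<phi> x \<noteq> 0}"
  by (simp add: test_fun_def compact_closure_support_iff)

lemma test_fun_smooth: "test_fun \<phi> \<Longrightarrow> smooth_fun \<phi>"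
  by (simp add: test_fun_iff)

lemma test_fun_lincomb:
  assumes "test_fun \<phi>" "test_fun \<psi>"
  shows "test_fun (\<lambda>x. a * \<phi> x + b * \<psi> x)"
proof -
  have "bounded {x. a * \<phi> x + b * \<psi> x \<noteq> 0}"
    by (rule bounded_subset[of "{x. \<phi> x \<noteq> 0} \<union> {x. \<psi> x \<noteq> 0}"]) (use assms in \<open>auto simp: test_fun_iff\<close>)
  then show ?thesis using assms smooth_fun_lincomb by (auto simp: test_fun_iff)
qed

lemma test_fun_zero: "test_fun (\<lambda>x. 0)"
  by (simp add: test_fun_iff smooth_fun_const)

lemma test_fun_sum:
  assumes "\<And>j. j \<in> J \<Longrightarrow> test_fun (f j)"
  shows "test_fun (\<lambda>x. \<Sum>j\<in>J. c j * f j x)"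
  using assms
proof (induction J rule: infinite_finite_induct)
  case (insert j J)
  have "test_fun (\<lambda>x. c j * f j x + 1 * (\<Sum>j\<in>J. c j * f j x))"
    by (rule test_fun_lincomb) (use insert in auto)
  then show ?case using insert.hyps by simp
qed (simp_all add: test_fun_zero)

lemma test_fun_mult:
  assumes "smooth_fun f" "test_fun \<phi>"
  shows "test_fun (\<lambda>x. f x * \<phi> x)"
proof -
  have "bounded {x. f x * \<phi> x \<noteq> 0}"
    by (rule bounded_subset[of "{x. \<phi> x \<noteq> 0}"]) (use assms in \<open>auto simp: test_fun_iff\<close>)
  then show ?thesis using assms smooth_fun_mult by (auto simp: test_fun_iff)
qed

lemma test_fun_shift:
  assumes "test_fun \<phi>"
  shows "test_fun (\<lambda>x. \<phi> (x - h))"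
proof -
  have "{x. \<phi> (x - h) \<noteq> 0} \<subseteq> (\<lambda>x. h + x) ` {x. \<phi> x \<noteq> 0}"
    by (auto simp: image_iff intro!: exI[of _ "_ - h"])
  then have "bounded {x. \<phi> (x - h) \<noteq> 0}"
    using assms bounded_subset bounded_translation by (metis test_fun_iff)
  then show ?thesis using assms smooth_fun_shift by (auto simp: test_fun_iff)
qed

text \<open>The equivalence matters because a distribution is 0 on functions that are not test
  functions; composition with a shift has to respect these as well.\<close>

lemma test_fun_shift_iff: "test_fun (\<lambda>x. \<phi> (x - h)) \<longleftrightarrow> test_fun \<phi>"
  using test_fun_shift[of \<phi> h] test_fun_shift[of "\<lambda>x. \<phi> (x - h)" "- h"] by auto

lemma test_fun_compose_orthogonal:
  assumes "test_fun \<phi>" "orthogonal_matrix P"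
  shows "test_fun (\<lambda>x. \<phi> (P *v x))"
proof -
  have n: "norm (P *v x) = norm x" for x
    using assms(2) orthogonal_transformation_norm[of "(*v) P"]
    by (simp add: orthogonal_transformation_matrix matrix_of_matrix_vector_mul)
  obtain B where "\<And>x. \<phi> x \<noteq> 0 \<Longrightarrow> norm x \<le> B"
    using assms unfolding test_fun_iff bounded_iff by blast
  then have "norm x \<le> B" if "\<phi> (P *v x) \<noteq> 0" for x using that n by metis
  then have "bounded {x. \<phi> (P *v x) \<noteq> 0}" unfolding bounded_iff by blast
  then show ?thesis using assms smooth_fun_compose_linear by (auto simp: test_fun_iff)
qed

section \<open>Distributions and convolution\<close>

text \<open>A point outside the closed support has a neighbourhood on which, by induction, the
  derivative of lower order vanishes identically.\<close>

lemma pds_support: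
  assumes "pds is \<phi> x \<noteq> 0"
  shows "x \<in> closure {x. \<phi> x \<noteq> 0}"
  using assms
proof (induction "is" arbitrary: x)
  case Nil
  then show ?case using closure_subset by fastforce
next
  case (Cons i "is")
  let ?K = "closure {x. \<phi> x \<noteq> 0}"
  show ?case
  proof (rule ccontr)
    assume x: "x \<notin> ?K"
    have "((\<lambda>t. x + t *\<^sub>R axis i 1) \<longlongrightarrow> x + 0 *\<^sub>R axis i 1) (nhds (0::real))"
      by (intro tendsto_intros filterlim_ident)
    then have "\<forall>\<^sub>F t in nhds 0. x + t *\<^sub>R axis i 1 \<in> - ?K"
      by (rule topological_tendstoD) (use x in auto)
    then have "\<forall>\<^sub>F t in nhds 0. pds is \<phi> (x + t *\<^sub>R axis i 1) = 0"
      by (rule eventually_mono) (use Cons.IH in blast)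
    then have "((\<lambda>t. pds is \<phi> (x + t *\<^sub>R axis i 1)) has_real_derivative 0) (at 0)
        \<longleftrightarrow> ((\<lambda>t::real. 0::real) has_real_derivative 0) (at 0)"
      by (intro DERIV_cong_ev) auto
    then have "partial i (pds is \<phi>) x = 0" by (intro partial_eqI) simp
    then show False using Cons.prems by simp
  qed
qed

lemma bounded_support_uniform:
  fixes f :: "real^'n \<Rightarrow> real"
  assumes "continuous_on UNIV f" "bounded {x. f x \<noteq> 0}" "e > 0"
  shows "\<exists>d>0. \<forall>x y. dist x y < d \<longrightarrow> \<bar>f x - f y\<bar> \<le> e"
proof -
  obtain R where R: "\<And>x. f x \<noteq> 0 \<Longrightarrow> norm x \<le> R"
    using assms(2) unfolding bounded_iff by auto
  \<comment> \<open>The radius \<open>R + 1\<close> leaves a margin: two points at distance below 1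
    either both lie in this ball or both lie outside the support.\<close>
  have "uniformly_continuous_on (cball 0 (R + 1)) f"
    by (intro compact_uniformly_continuous continuous_on_subset[OF assms(1)]) auto
  then obtain d where d: "d > 0" "\<And>x y. x \<in> cball 0 (R + 1) \<Longrightarrow> y \<in> cball 0 (R + 1) \<Longrightarrow> dist y x < d \<Longrightarrow> dist (f y) (f x) < e"
    unfolding uniformly_continuous_on_def using \<open>e > 0\<close> by metis
  have "\<bar>f x - f y\<bar> \<le> e" if xy: "dist x y < min d 1" for x y
  proof (cases "x \<in> cball 0 (R + 1) \<and> y \<in> cball 0 (R + 1)")
    case True
    then show ?thesis using d(2)[of y x] xy by (simp add: dist_real_def)
  next
    case False
    have "norm x \<le> norm y + dist x y" "norm y \<le> norm x + dist x y"
      using norm_triangle_sub[of x y] norm_triangle_sub[of y x] by (simp_all add: dist_norm norm_minus_commute)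
    then have "norm x > R" "norm y > R" using False xy by auto
    then have "f x = 0" "f y = 0" using R by (metis not_le)+
    then show ?thesis using \<open>e > 0\<close> by simp
  qed
  then show ?thesis using d(1) by (intro exI[of _ "min d 1"]) auto
qed

lemma test_fun_pds_uniform:
  fixes \<phi> :: "real^'n \<Rightarrow> real"
  assumes "test_fun \<phi>" "e > 0"
  shows "\<exists>d>0. \<forall>is x y. length is \<le> N \<longrightarrow> dist x y < d \<longrightarrow> \<bar>pds is \<phi> x - pds is \<phi> y\<bar> \<le> e"
proof -
  let ?L = "{is :: 'n list. set is \<subseteq> UNIV \<and> length is \<le> N}"
  have fin: "finite ?L" by (rule finite_lists_length_le) simp
  have ne: "?L \<noteq> {}" by (auto intro!: exI[of _ "[]"])
  have "\<exists>d>0. \<forall>x y. dist x y < d \<longrightarrow> \<bar>pds is \<phi> x - pds is \<phi> y\<bar> \<le> e" for "is"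
  proof (rule bounded_support_uniform[OF _ _ assms(2)])
    show "continuous_on UNIV (pds is \<phi>)"
      using assms(1) by (intro smooth_fun_continuous_on smooth_fun_pds test_fun_smooth)
    have "{x. pds is \<phi> x \<noteq> 0} \<subseteq> closure {x. \<phi> x \<noteq> 0}" using pds_support by blast
    then show "bounded {x. pds is \<phi> x \<noteq> 0}"
      using assms(1) bounded_subset bounded_closure unfolding test_fun_iff by metis
  qed
  then obtain d where d: "\<And>is. d is > 0" "\<And>is x y. dist x y < d is \<Longrightarrow> \<bar>pds is \<phi> x - pds is \<phi> y\<bar> \<le> e"
    by metis
  have "Min (d ` ?L) > 0" using fin ne d(1) by (subst Min_gr_iff) auto
  moreover have "\<bar>pds is \<phi> x - pds is \<phi> y\<bar> \<le> e" if "length is \<le> N" "dist x y < Min (d ` ?L)" for "is" x y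
  proof -
    have "Min (d ` ?L) \<le> d is" using fin that(1) by (intro Min_le) auto
    then show ?thesis using d(2) that(2) by (meson less_le_trans)
  qed
  ultimately show ?thesis by blast
qed

lemma distribution_lincomb:
  "distribution T \<Longrightarrow> test_fun \<phi> \<Longrightarrow> test_fun \<psi> \<Longrightarrow> T (\<lambda>x. a * \<phi> x + b * \<psi> x) = a * T \<phi> + b * T \<psi>"
  unfolding distribution_def by blast

lemma distribution_nontest: "distribution T \<Longrightarrow> \<not> test_fun \<phi> \<Longrightarrow> T \<phi> = 0"
  unfolding distribution_def by blast

lemma distribution_zero: "distribution T \<Longrightarrow> T (\<lambda>x. 0) = 0"
  using distribution_lincomb[of T "\<lambda>x. 0" "\<lambda>x. 0" 0 0] test_fun_zero by simp

lemma distribution_sum: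
  assumes "distribution T" "\<And>j. j \<in> J \<Longrightarrow> test_fun (f j)"
  shows "T (\<lambda>x. \<Sum>j\<in>J. c j * f j x) = (\<Sum>j\<in>J. c j * T (f j))"
  using assms(2)
proof (induction J rule: infinite_finite_induct)
  case (insert j J)
  have "T (\<lambda>x. c j * f j x + 1 * (\<Sum>j\<in>J. c j * f j x)) = c j * T (f j) + 1 * T (\<lambda>x. \<Sum>j\<in>J. c j * f j x)"
    using insert by (intro distribution_lincomb assms(1) test_fun_sum) auto
  then show ?case using insert by simp
qed (simp_all add: distribution_zero assms)

lemma distribution_bound:
  fixes T :: "(real^'n \<Rightarrow> real) \<Rightarrow> real"
  assumes "distribution T" "compact K"
  obtains C N where "C \<ge> 0" "\<And>\<phi> M. test_fun \<phi> \<Longrightarrow> {x. \<phi> x \<noteq> 0} \<subseteq> K \<Longrightarrow>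
    (\<And>is x. length is \<le> N \<Longrightarrow> \<bar>pds is \<phi> x\<bar> \<le> M) \<Longrightarrow> \<bar>T \<phi>\<bar> \<le> C * M"
proof -
  obtain C N where CN: "\<And>\<phi> M. test_fun \<phi> \<Longrightarrow> {x. \<phi> x \<noteq> 0} \<subseteq> K \<Longrightarrow>
    (\<forall>is x. length is \<le> N \<longrightarrow> \<bar>pds is \<phi> x\<bar> \<le> M) \<Longrightarrow> \<bar>T \<phi>\<bar> \<le> C * M"
    using assms unfolding distribution_def by blast
  have *: "\<bar>T \<phi>\<bar> \<le> \<bar>C\<bar> * M" if "test_fun \<phi>" "{x. \<phi> x \<noteq> 0} \<subseteq> K"
    "\<And>is x. length is \<le> N \<Longrightarrow> \<bar>pds is \<phi> x\<bar> \<le> M" for \<phi> M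
  proof -
    have "\<bar>pds [] \<phi> 0\<bar> \<le> M" by (rule that(3)) simp
    then have "M \<ge> 0" using abs_ge_zero order_trans by blast
    then have "C * M \<le> \<bar>C\<bar> * M" by (intro mult_right_mono) auto
    moreover have "\<bar>T \<phi>\<bar> \<le> C * M" using CN that by blast
    ultimately show ?thesis by linarith
  qed
  show ?thesis
  proof (rule that[of "\<bar>C\<bar>" N])
    show "0 \<le> \<bar>C\<bar>" by simp
  qed (fact *)
qed

section \<open>Convolution over a box\<close>

text \<open>This is the convolution of \<open>\<phi>\<close> and \<open>\<psi>\<close> when the box
  contains the support of \<open>\<psi>\<close>. A fixed compact box permits differentiation under
  the integral and Riemann sums before supports come into play.\<close>

definition box_conv :: "real^'n \<Rightarrow> real^'n \<Rightarrow> (real^'n \<Rightarrow> real) \<Rightarrow> (real^'n \<Rightarrow> real) \<Rightarrow> real^'n \<Rightarrow> real" where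
  "box_conv a b \<phi> \<psi> x = integral (cbox a b) (\<lambda>h. \<phi> (x - h) * \<psi> h)"

lemma box_conv_continuous:
  assumes "continuous_on UNIV \<phi>" "continuous_on UNIV \<psi>"
  shows "continuous_on UNIV (box_conv a b \<phi> \<psi>)"
proof -
  have "continuous_on (UNIV \<times> cbox a b) (\<lambda>(x, h). \<phi> (x - h) * \<psi> h)"
    unfolding split_beta
    by (intro continuous_intros continuous_on_compose2[OF assms(1)] continuous_on_compose2[OF assms(2)]) auto
  then show ?thesis unfolding box_conv_def by (rule integral_continuous_on_param)
qed

text \<open>Differentiation under the integral puts all derivatives on \<open>\<phi>\<close>, so
  that continuity is enough for \<open>\<psi>\<close>.\<close>

lemma box_conv_has_partial:
  assumes "smooth_fun \<phi>" "continuous_on UNIV \<psi>"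
  shows "((\<lambda>t. box_conv a b \<phi> \<psi> (x + t *\<^sub>R axis i 1)) has_real_derivative box_conv a b (partial i \<phi>) \<psi> x) (at 0)"
proof -
  have "((\<lambda>t. integral (cbox a b) (\<lambda>h. \<phi> (x + t *\<^sub>R axis i 1 - h) * \<psi> h)) has_real_derivative
      integral (cbox a b) (\<lambda>h. partial i \<phi> (x + 0 *\<^sub>R axis i 1 - h) * \<psi> h)) (at 0 within UNIV)"
  proof (rule leibniz_rule_field_derivative)
    fix t :: real and h
    have "((\<lambda>t. \<phi> ((x - h) + t *\<^sub>R axis i 1)) has_real_derivative partial i \<phi> ((x - h) + t *\<^sub>R axis i 1)) (at t)"
      by (rule smooth_fun_has_partial[OF assms(1)])
    then have "((\<lambda>t. \<phi> (x + t *\<^sub>R axis i 1 - h)) has_real_derivative partial i \<phi> (x + t *\<^sub>R axis i 1 - h)) (at t)"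
      by (simp add: algebra_simps)
    then show "((\<lambda>t. \<phi> (x + t *\<^sub>R axis i 1 - h) * \<psi> h) has_real_derivative partial i \<phi> (x + t *\<^sub>R axis i 1 - h) * \<psi> h) (at t within UNIV)"
      by (rule DERIV_cmult_right)
    show "(\<lambda>h. \<phi> (x + t *\<^sub>R axis i 1 - h) * \<psi> h) integrable_on cbox a b"
      by (intro integrable_continuous continuous_intros
          continuous_on_compose2[OF smooth_fun_continuous_on[OF assms(1), of UNIV]] continuous_on_subset[OF assms(2)]) auto
    show "continuous_on (UNIV \<times> cbox a b) (\<lambda>(t, h). partial i \<phi> (x + t *\<^sub>R axis i 1 - h) * \<psi> h)"
      unfolding split_beta
      by (intro continuous_intros continuous_on_compose2[OF assms(2)]
          continuous_on_compose2[OF smooth_fun_continuous_on[OF smooth_fun_partial[OF assms(1)], of UNIV]]) auto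
  qed auto
  then show ?thesis by (simp add: box_conv_def)
qed

lemma smooth_fun_box_conv:
  assumes "smooth_fun \<phi>" "continuous_on UNIV \<psi>"
  shows "smooth_fun (box_conv a b \<phi> \<psi>)"
proof (rule smooth_fun_coinduct[where C = "\<lambda>f. \<exists>\<phi>. smooth_fun \<phi> \<and> f = box_conv a b \<phi> \<psi>"])
  show "\<exists>\<phi>'. smooth_fun \<phi>' \<and> box_conv a b \<phi> \<psi> = box_conv a b \<phi>' \<psi>" using assms by blast
next
  fix f assume "\<exists>\<phi>. smooth_fun \<phi> \<and> f = box_conv a b \<phi> \<psi>"
  then obtain \<phi> where \<phi>: "smooth_fun \<phi>" "f = box_conv a b \<phi> \<psi>" by blast
  show "continuous_on UNIV f"
    unfolding \<phi>(2) by (intro box_conv_continuous smooth_fun_continuous_on \<phi> assms)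
  note D = box_conv_has_partial[OF \<phi>(1) assms(2)]
  show "(\<lambda>t. f (x + t *\<^sub>R axis i 1)) differentiable (at 0)" for i x
    unfolding \<phi>(2) using D real_differentiable_def by blast
  have "partial i f = box_conv a b (partial i \<phi>) \<psi>" for i
    unfolding \<phi>(2) by (rule ext) (rule partial_eqI[OF D])
  then show "\<exists>\<phi>. smooth_fun \<phi> \<and> partial i f = box_conv a b \<phi> \<psi>" for i
    using smooth_fun_partial[OF \<phi>(1)] by blast
qed

lemma pds_box_conv:
  assumes "smooth_fun \<phi>" "continuous_on UNIV \<psi>"
  shows "pds is (box_conv a b \<phi> \<psi>) = box_conv a b (pds is \<phi>) \<psi>"
proof (induction "is")
  case (Cons i "is")
  have "partial i (box_conv a b (pds is \<phi>) \<psi>) = box_conv a b (partial i (pds is \<phi>)) \<psi>"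
    by (rule ext) (intro partial_eqI box_conv_has_partial smooth_fun_pds assms)
  then show ?case using Cons by simp
qed simp

lemma box_conv_support:
  assumes "box_conv a b \<phi> \<psi> x \<noteq> 0"
  shows "\<exists>y h. \<phi> y \<noteq> 0 \<and> h \<in> cbox a b \<and> x = y + h"
proof -
  have "\<exists>h\<in>cbox a b. \<phi> (x - h) * \<psi> h \<noteq> 0"
  proof (rule ccontr)
    assume "\<not> ?thesis"
    then have "box_conv a b \<phi> \<psi> x = integral (cbox a b) (\<lambda>h. 0)"
      unfolding box_conv_def by (intro integral_cong) auto
    then show False using assms by simp
  qed
  then obtain h where "h \<in> cbox a b" "\<phi> (x - h) \<noteq> 0" by auto
  then show ?thesis by (intro exI[of _ "x - h"] exI[of _ h]) auto
qed

section \<open>Distributions under the integral sign\<close>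

text \<open>Only \<open>\<Phi>\<close> is sampled at the tags, while \<open>\<psi>\<close> is
  integrated exactly over each cell; the error therefore involves the oscillation of
  \<open>\<Phi>\<close> and merely a bound on \<open>\<psi>\<close>. The estimate is applied both to
  derivatives of \<open>\<phi>\<close> and to the values of \<open>T\<close> on translates.\<close>

lemma riemann_approx:
  fixes \<Phi> \<psi> :: "real^'n \<Rightarrow> real"
  assumes \<Phi>: "continuous_on UNIV \<Phi>" and \<psi>: "continuous_on UNIV \<psi>"
    and M: "\<And>h. h \<in> cbox a b \<Longrightarrow> \<bar>\<psi> h\<bar> \<le> M"
    and p: "p tagged_division_of (cbox a b)" "(\<lambda>h. ball h d) fine p"
    and e: "\<And>h h'. h \<in> cbox a b \<Longrightarrow> h' \<in> cbox a b \<Longrightarrow> dist h h' < d \<Longrightarrow> \<bar>\<Phi> h' - \<Phi> h\<bar> \<le> e"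
    and nn: "0 \<le> e" "0 \<le> M"
  shows "\<bar>integral (cbox a b) (\<lambda>h. \<Phi> h * \<psi> h) - (\<Sum>j\<in>p. integral (snd j) \<psi> * \<Phi> (fst j))\<bar> \<le> e * M * measure lborel (cbox a b)"
proof -
  have int: "f integrable_on K" if f: "continuous_on UNIV f" "(h, K) \<in> p" for f :: "real^'n \<Rightarrow> real" and h K
  proof -
    obtain u v where "K = cbox u v" using tagged_division_ofD(4)[OF p(1) f(2)] by blast
    then show ?thesis using integrable_continuous continuous_on_subset[OF f(1)] by auto
  qed
  have c: "continuous_on UNIV (\<lambda>h. \<Phi> h * \<psi> h)" by (intro continuous_intros \<Phi> \<psi>)
  have "integral (cbox a b) (\<lambda>h. \<Phi> h * \<psi> h) = (\<Sum>j\<in>p. integral (snd j) (\<lambda>h. \<Phi> h * \<psi> h))"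
    using integral_combine_tagged_division_bottomup[OF p(1) int[OF c]] by (simp add: split_beta)
  then have "integral (cbox a b) (\<lambda>h. \<Phi> h * \<psi> h) - (\<Sum>j\<in>p. integral (snd j) \<psi> * \<Phi> (fst j))
      = (\<Sum>j\<in>p. integral (snd j) (\<lambda>h. \<Phi> h * \<psi> h) - integral (snd j) \<psi> * \<Phi> (fst j))"
    by (simp add: sum_subtractf)
  also have "\<bar>\<dots>\<bar> \<le> (\<Sum>j\<in>p. e * M * measure lborel (snd j))"
  proof (rule order_trans[OF sum_abs], rule sum_mono)
    fix j assume "j \<in> p"
    then obtain h K where j: "j = (h, K)" "(h, K) \<in> p" by (cases j) auto
    obtain u v where K: "K = cbox u v" using tagged_division_ofD(4)[OF p(1) j(2)] by blast
    have sub: "K \<subseteq> cbox a b" and h: "h \<in> K" using tagged_division_ofD(2,3)[OF p(1) j(2)] by auto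
    have fine: "K \<subseteq> ball h d" using p(2) j(2) unfolding fine_def by blast
    have "integral K (\<lambda>h. \<Phi> h * \<psi> h) - integral K \<psi> * \<Phi> h
        = integral K (\<lambda>h'. \<Phi> h' * \<psi> h') - integral K (\<lambda>h'. \<psi> h' * \<Phi> h)"
      by simp
    also have "\<dots> = integral K (\<lambda>h'. \<Phi> h' * \<psi> h' - \<psi> h' * \<Phi> h)"
      by (rule integral_diff[symmetric]) (intro int[OF _ j(2)] continuous_intros \<Phi> \<psi>)+
    finally have eq: "integral K (\<lambda>h. \<Phi> h * \<psi> h) - integral K \<psi> * \<Phi> h
        = integral K (\<lambda>h'. \<Phi> h' * \<psi> h' - \<psi> h' * \<Phi> h)" .
    have "norm (integral K (\<lambda>h'. \<Phi> h' * \<psi> h' - \<psi> h' * \<Phi> h)) \<le> e * M * measure lborel (cbox u v)"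
    proof (rule has_integral_bound)
      show "0 \<le> e * M" using nn by simp
      show "((\<lambda>h'. \<Phi> h' * \<psi> h' - \<psi> h' * \<Phi> h) has_integral integral K (\<lambda>h'. \<Phi> h' * \<psi> h' - \<psi> h' * \<Phi> h)) (cbox u v)"
        unfolding K[symmetric] by (intro integrable_integral int[OF _ j(2)] continuous_intros \<Phi> \<psi>)
      fix h' assume "h' \<in> cbox u v"
      then have h': "h' \<in> cbox a b" "dist h h' < d" using sub fine K by auto
      have "\<bar>\<Phi> h' - \<Phi> h\<bar> * \<bar>\<psi> h'\<bar> \<le> e * M"
        using e[OF _ h'(1,2)] M[OF h'(1)] h sub nn by (intro mult_mono) auto
      then show "norm (\<Phi> h' * \<psi> h' - \<psi> h' * \<Phi> h) \<le> e * M"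
        by (simp add: abs_mult[symmetric] algebra_simps)
    qed
    then show "\<bar>integral (snd j) (\<lambda>h. \<Phi> h * \<psi> h) - integral (snd j) \<psi> * \<Phi> (fst j)\<bar> \<le> e * M * measure lborel (snd j)"
      using eq j K by simp
  qed
  also have "\<dots> = e * M * measure lborel (cbox a b)"
    using additive_content_tagged_division[OF p(1)] by (simp add: sum_distrib_left[symmetric] split_beta)
  finally show ?thesis .
qed

text \<open>The seminorm estimate is fixed once, for a compact set containing all translates of the
  support by vectors of the box. The second part applies it to a difference of two translates.
  Sharing \<open>C\<close> and \<open>N\<close> lets both errors in
  \<open>distribution_box_conv\<close> be controlled together.\<close>

lemma distribution_shift_modulus:
  fixes T :: "(real^'n \<Rightarrow> real) \<Rightarrow> real"
  assumes T: "distribution T" and \<phi>: "test_fun \<phi>"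
  shows "\<exists>C N. C \<ge> 0 \<and>
    (\<forall>g M. test_fun g \<longrightarrow> (\<forall>x. g x \<noteq> 0 \<longrightarrow> (\<exists>y h. \<phi> y \<noteq> 0 \<and> h \<in> cbox a b \<and> x = y + h)) \<longrightarrow>
      (\<forall>is x. length is \<le> N \<longrightarrow> \<bar>pds is g x\<bar> \<le> M) \<longrightarrow> \<bar>T g\<bar> \<le> C * M) \<and>
    (\<forall>h\<in>cbox a b. \<forall>h'\<in>cbox a b. \<forall>e.
      (\<forall>is x y. length is \<le> N \<longrightarrow> dist x y \<le> dist h h' \<longrightarrow> \<bar>pds is \<phi> x - pds is \<phi> y\<bar> \<le> e) \<longrightarrow>
      \<bar>T (\<lambda>x. \<phi> (x - h')) - T (\<lambda>x. \<phi> (x - h))\<bar> \<le> C * e)"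
proof -
  let ?K = "{x + y | x y. x \<in> closure {x. \<phi> x \<noteq> 0} \<and> y \<in> cbox a b}"
  have "compact ?K" using \<phi> by (intro compact_sums) (auto simp: test_fun_def)
  from distribution_bound[OF T this]
  obtain C N where CN: "C \<ge> 0" "\<And>g M. test_fun g \<Longrightarrow> {x. g x \<noteq> 0} \<subseteq> ?K \<Longrightarrow>
    (\<And>is x. length is \<le> N \<Longrightarrow> \<bar>pds is g x\<bar> \<le> M) \<Longrightarrow> \<bar>T g\<bar> \<le> C * M"
    by blast
  have *: "\<bar>T g\<bar> \<le> C * M" if g: "test_fun g"
      "\<forall>x. g x \<noteq> 0 \<longrightarrow> (\<exists>y h. \<phi> y \<noteq> 0 \<and> h \<in> cbox a b \<and> x = y + h)"
      "\<forall>is x. length is \<le> N \<longrightarrow> \<bar>pds is g x\<bar> \<le> M" for g M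
  proof (rule CN(2)[OF g(1)])
    show "{x. g x \<noteq> 0} \<subseteq> ?K"
    proof
      fix x assume "x \<in> {x. g x \<noteq> 0}"
      then obtain y h where "\<phi> y \<noteq> 0" "h \<in> cbox a b" "x = y + h" using g(2) by blast
      moreover from this have "y \<in> closure {x. \<phi> x \<noteq> 0}" using closure_subset by fastforce
      ultimately show "x \<in> ?K" by blast
    qed
  qed (use g(3) in blast)
  show ?thesis
  proof (intro exI[of _ C] exI[of _ N] conjI allI ballI impI)
    show "C \<ge> 0" by (fact CN(1))
    show "\<bar>T g\<bar> \<le> C * M" if "test_fun g"
      "\<forall>x. g x \<noteq> 0 \<longrightarrow> (\<exists>y h. \<phi> y \<noteq> 0 \<and> h \<in> cbox a b \<and> x = y + h)"
      "\<forall>is x. length is \<le> N \<longrightarrow> \<bar>pds is g x\<bar> \<le> M" for g M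
      by (rule *[OF that])
    fix h h' e
    assume h: "h \<in> cbox a b" "h' \<in> cbox a b"
      and e: "\<forall>is x y. length is \<le> N \<longrightarrow> dist x y \<le> dist h h' \<longrightarrow> \<bar>pds is \<phi> x - pds is \<phi> y\<bar> \<le> e"
    let ?g = "\<lambda>x. 1 * \<phi> (x - h') + (-1) * \<phi> (x - h)"
    have t: "test_fun (\<lambda>x. \<phi> (x - h))" "test_fun (\<lambda>x. \<phi> (x - h'))" using \<phi> by (auto intro: test_fun_shift)
    have "\<bar>T ?g\<bar> \<le> C * e"
    proof (rule *, safe)
      show "test_fun ?g" by (intro test_fun_lincomb t)
      show "\<exists>y k. \<phi> y \<noteq> 0 \<and> k \<in> cbox a b \<and> x = y + k" if x: "?g x \<noteq> 0" for x
      proof (cases "\<phi> (x - h) = 0")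
        case True
        then have "\<phi> (x - h') \<noteq> 0" using x by auto
        then show ?thesis using h by (intro exI[of _ "x - h'"] exI[of _ h']) auto
      next
        case False
        then show ?thesis using h by (intro exI[of _ "x - h"] exI[of _ h]) auto
      qed
      fix "is" :: "'n list" and x assume l: "length is \<le> N"
      have "pds is ?g x = 1 * pds is \<phi> (x - h') + (-1) * pds is \<phi> (x - h)"
        by (subst pds_lincomb) (use t in \<open>auto simp: pds_shift test_fun_smooth\<close>)
      then show "\<bar>pds is ?g x\<bar> \<le> e"
        using e[rule_format, OF l, of "x - h'" "x - h"] by (simp add: dist_norm norm_minus_commute)
    qed
    moreover have "T ?g = 1 * T (\<lambda>x. \<phi> (x - h')) + (-1) * T (\<lambda>x. \<phi> (x - h))"
      by (rule distribution_lincomb[OF T t(2,1)])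
    ultimately show "\<bar>T (\<lambda>x. \<phi> (x - h')) - T (\<lambda>x. \<phi> (x - h))\<bar> \<le> C * e" by simp
  qed
qed

lemma distribution_shift_continuous:
  fixes T :: "(real^'n \<Rightarrow> real) \<Rightarrow> real"
  assumes T: "distribution T" and \<phi>: "test_fun \<phi>"
  shows "continuous_on UNIV (\<lambda>h. T (\<lambda>x. \<phi> (x - h)))"
  unfolding continuous_on_iff
proof (intro ballI allI impI)
  fix h0 :: "real^'n" and e :: real assume e: "e > 0"
  obtain u where u: "cball h0 1 \<subseteq> cbox (-u) u"
    using bounded_subset_cbox_symmetric[OF bounded_cball] by blast
  obtain C N where C: "C \<ge> 0" and CN: "\<forall>h\<in>cbox (-u) u. \<forall>h'\<in>cbox (-u) u. \<forall>e.
      (\<forall>is x y. length is \<le> N \<longrightarrow> dist x y \<le> dist h h' \<longrightarrow> \<bar>pds is \<phi> x - pds is \<phi> y\<bar> \<le> e) \<longrightarrow>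
      \<bar>T (\<lambda>x. \<phi> (x - h')) - T (\<lambda>x. \<phi> (x - h))\<bar> \<le> C * e"
    using distribution_shift_modulus[OF T \<phi>, of "-u" u] by (elim exE conjE)
  \<comment> \<open>The summand 1 in the denominator keeps it positive when
    \<open>C = 0\<close>.\<close>
  define e' where "e' = e / (2 * (C + 1))"
  have e': "e' > 0" using e C by (simp add: e'_def)
  have "C * e' \<le> (C + 1) * e'" using e' by (intro mult_right_mono) auto
  also have "\<dots> = e / 2" using C by (simp add: e'_def field_simps)
  finally have Ce: "C * e' < e" using e by simp
  obtain d where d: "d > 0" "\<And>is x y. length is \<le> N \<Longrightarrow> dist x y < d \<Longrightarrow> \<bar>pds is \<phi> x - pds is \<phi> y\<bar> \<le> e'"
    using test_fun_pds_uniform[OF \<phi> e', of N] by blast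
  show "\<exists>d>0. \<forall>h\<in>UNIV. dist h h0 < d \<longrightarrow> dist (T (\<lambda>x. \<phi> (x - h))) (T (\<lambda>x. \<phi> (x - h0))) < e"
  proof (intro exI[of _ "min d 1"] conjI ballI impI)
    show "min d 1 > 0" using d by simp
    fix h assume h: "dist h h0 < min d 1"
    have "\<bar>T (\<lambda>x. \<phi> (x - h)) - T (\<lambda>x. \<phi> (x - h0))\<bar> \<le> C * e'"
    proof (rule CN[rule_format])
      show "h0 \<in> cbox (-u) u" "h \<in> cbox (-u) u" using u h by (auto simp: subset_iff dist_commute)
      show "\<bar>pds is \<phi> x - pds is \<phi> y\<bar> \<le> e'" if "length is \<le> N" "dist x y \<le> dist h0 h" for "is" x y
        using d(2)[OF that(1), of x y] that(2) h by (simp add: dist_commute)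
    qed
    then show "dist (T (\<lambda>x. \<phi> (x - h))) (T (\<lambda>x. \<phi> (x - h0))) < e"
      using Ce by (simp add: dist_real_def)
  qed
qed

lemma le_zero_if_le_mult_eps:
  fixes x K :: real
  assumes "K \<ge> 0" "\<And>e. e > 0 \<Longrightarrow> x \<le> K * e"
  shows "x \<le> 0"
proof (rule ccontr)
  assume "\<not> x \<le> 0"
  then have x: "x > 0" by simp
  let ?e = "x / (2 * (K + 1))"
  have "?e > 0" using x assms(1) by simp
  then have "x \<le> K * ?e" by (rule assms(2))
  also have "\<dots> \<le> (K + 1) * ?e" using \<open>?e > 0\<close> by (intro mult_right_mono) auto
  also have "\<dots> = x / 2" using assms(1) by (simp add: field_simps)
  finally show False using x by simp
qed

lemma test_fun_box_conv:
  assumes "test_fun \<phi>" "continuous_on UNIV \<psi>"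
  shows "test_fun (box_conv a b \<phi> \<psi>)"
proof -
  have "bounded ((\<lambda>(x, y). x + y) ` ({x. \<phi> x \<noteq> 0} \<times> cbox a b))"
    using assms(1) by (intro bounded_plus) (auto simp: test_fun_iff)
  moreover have "{x. box_conv a b \<phi> \<psi> x \<noteq> 0} \<subseteq> (\<lambda>(x, y). x + y) ` ({x. \<phi> x \<noteq> 0} \<times> cbox a b)"
  proof
    fix x assume "x \<in> {x. box_conv a b \<phi> \<psi> x \<noteq> 0}"
    then obtain y h where "\<phi> y \<noteq> 0" "h \<in> cbox a b" "x = y + h" using box_conv_support by blast
    then show "x \<in> (\<lambda>(x, y). x + y) ` ({x. \<phi> x \<noteq> 0} \<times> cbox a b)" by (intro image_eqI[of _ _ "(y, h)"]) auto
  qed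
  ultimately have "bounded {x. box_conv a b \<phi> \<psi> x \<noteq> 0}" by (rule bounded_subset)
  then show ?thesis using smooth_fun_box_conv assms by (auto simp: test_fun_iff)
qed

text \<open>The sums \<open>R\<close> approximate the convolution together with all derivatives up
  to order \<open>N\<close>, so \<open>T R\<close> approximates the left-hand side by the seminorm
  estimate. By linearity \<open>T R\<close> is at the same time an approximating sum for the
  right-hand side, over the same tagged division.\<close>

lemma distribution_box_conv:
  fixes T :: "(real^'n \<Rightarrow> real) \<Rightarrow> real"
  assumes T: "distribution T" and \<phi>: "test_fun \<phi>" and \<psi>: "continuous_on UNIV \<psi>"
  shows "T (box_conv a b \<phi> \<psi>) = integral (cbox a b) (\<lambda>h. T (\<lambda>x. \<phi> (x - h)) * \<psi> h)"
proof -
  obtain C N where C: "C \<ge> 0"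
    and bound: "\<forall>g M. test_fun g \<longrightarrow> (\<forall>x. g x \<noteq> 0 \<longrightarrow> (\<exists>y h. \<phi> y \<noteq> 0 \<and> h \<in> cbox a b \<and> x = y + h)) \<longrightarrow>
      (\<forall>is x. length is \<le> N \<longrightarrow> \<bar>pds is g x\<bar> \<le> M) \<longrightarrow> \<bar>T g\<bar> \<le> C * M"
    and modulus: "\<forall>h\<in>cbox a b. \<forall>h'\<in>cbox a b. \<forall>e.
      (\<forall>is x y. length is \<le> N \<longrightarrow> dist x y \<le> dist h h' \<longrightarrow> \<bar>pds is \<phi> x - pds is \<phi> y\<bar> \<le> e) \<longrightarrow>
      \<bar>T (\<lambda>x. \<phi> (x - h')) - T (\<lambda>x. \<phi> (x - h))\<bar> \<le> C * e"
    using distribution_shift_modulus[OF T \<phi>, of a b] by (elim exE conjE)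
  let ?F = "\<lambda>h. T (\<lambda>x. \<phi> (x - h))"
  let ?g = "box_conv a b \<phi> \<psi>"
  let ?I = "integral (cbox a b) (\<lambda>h. ?F h * \<psi> h)"
  let ?c = "measure lborel (cbox a b)"
  have "bounded (\<psi> ` cbox a b)"
    by (intro compact_imp_bounded compact_continuous_image continuous_on_subset[OF \<psi>]) auto
  then obtain M where M: "0 < M" "\<And>h. h \<in> cbox a b \<Longrightarrow> \<bar>\<psi> h\<bar> \<le> M"
    unfolding bounded_pos by auto
  have sm: "smooth_fun \<phi>" by (rule test_fun_smooth[OF \<phi>])
  have tg: "test_fun ?g" by (rule test_fun_box_conv[OF \<phi> \<psi>])
  have "\<bar>T ?g - ?I\<bar> \<le> (2 * C * M * ?c) * e" if e: "e > 0" for e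
  proof -
    obtain d where d: "d > 0" "\<And>is x y. length is \<le> N \<Longrightarrow> dist x y < d \<Longrightarrow> \<bar>pds is \<phi> x - pds is \<phi> y\<bar> \<le> e"
      using test_fun_pds_uniform[OF \<phi> e, of N] by blast
    obtain p where p: "p tagged_division_of (cbox a b)" "(\<lambda>h. ball h d) fine p"
      using fine_division_exists[OF gauge_ball[OF d(1)]] by blast
    define R where "R x = (\<Sum>j\<in>p. integral (snd j) \<psi> * \<phi> (x - fst j))" for x
    have tR: "test_fun R" unfolding R_def by (intro test_fun_sum test_fun_shift \<phi>)
    have TR: "T R = (\<Sum>j\<in>p. integral (snd j) \<psi> * ?F (fst j))"
      unfolding R_def by (rule distribution_sum[OF T]) (rule test_fun_shift[OF \<phi>])
    let ?D = "\<lambda>x. 1 * ?g x + (-1) * R x"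
    have "\<bar>T ?D\<bar> \<le> C * (e * M * ?c)"
    proof (rule bound[rule_format])
      show "test_fun ?D" by (intro test_fun_lincomb tg tR)
      show "\<exists>y h. \<phi> y \<noteq> 0 \<and> h \<in> cbox a b \<and> x = y + h" if x: "?D x \<noteq> 0" for x
      proof (cases "?g x = 0")
        case True
        then have "R x \<noteq> 0" using x by auto
        then obtain j where j: "j \<in> p" "\<phi> (x - fst j) \<noteq> 0"
          unfolding R_def by (metis (no_types, lifting) mult_zero_right sum.neutral)
        then have "fst j \<in> cbox a b"
          using tagged_division_ofD(2,3)[OF p(1), of "fst j" "snd j"] by auto
        then show ?thesis using j by (intro exI[of _ "x - fst j"] exI[of _ "fst j"]) auto
      next
        case False
        then show ?thesis by (rule box_conv_support)
      qed
      fix "is" :: "'n list" and x assume l: "length is \<le> N"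
      have "pds is ?D x = 1 * pds is ?g x + (-1) * pds is R x"
        by (subst pds_lincomb) (use tg tR test_fun_smooth in auto)
      also have "pds is ?g x = integral (cbox a b) (\<lambda>h. pds is \<phi> (x - h) * \<psi> h)"
        by (simp add: pds_box_conv[OF sm \<psi>] box_conv_def)
      also have "pds is R x = (\<Sum>j\<in>p. integral (snd j) \<psi> * pds is \<phi> (x - fst j))"
        unfolding R_def by (subst pds_sum) (auto simp: pds_shift intro: smooth_fun_shift[OF sm])
      finally have eq: "pds is ?D x = integral (cbox a b) (\<lambda>h. pds is \<phi> (x - h) * \<psi> h)
          - (\<Sum>j\<in>p. integral (snd j) \<psi> * pds is \<phi> (x - fst j))" by simp
      show "\<bar>pds is ?D x\<bar> \<le> e * M * ?c"
        unfolding eq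
      proof (rule riemann_approx[OF _ \<psi> M(2) p])
        show "continuous_on UNIV (\<lambda>h. pds is \<phi> (x - h))"
          by (rule continuous_on_compose2[OF smooth_fun_continuous_on[OF smooth_fun_pds[OF sm]]])
            (auto intro!: continuous_intros)
        show "\<bar>pds is \<phi> (x - h') - pds is \<phi> (x - h)\<bar> \<le> e" if "dist h h' < d" for h h'
          using d(2)[OF l, of "x - h'" "x - h"] that by (simp add: dist_norm)
      qed (use e M in auto)
    qed
    moreover have "T ?D = 1 * T ?g + (-1) * T R" by (rule distribution_lincomb[OF T tg tR])
    ultimately have 1: "\<bar>T ?g - T R\<bar> \<le> C * (e * M * ?c)" by simp
    have 2: "\<bar>?I - T R\<bar> \<le> C * e * M * ?c"
      unfolding TR
    proof (rule riemann_approx[OF distribution_shift_continuous[OF T \<phi>] \<psi> M(2) p])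
      show "\<bar>?F h' - ?F h\<bar> \<le> C * e" if h: "h \<in> cbox a b" "h' \<in> cbox a b" "dist h h' < d" for h h'
      proof (rule modulus[rule_format, OF h(1,2)])
        show "\<bar>pds is \<phi> x - pds is \<phi> y\<bar> \<le> e" if "length is \<le> N" "dist x y \<le> dist h h'" for "is" x y
          using d(2)[OF that(1)] that(2) h(3) by auto
      qed
    qed (use e M C in auto)
    have "\<bar>T ?g - ?I\<bar> \<le> \<bar>T ?g - T R\<bar> + \<bar>?I - T R\<bar>" by linarith
    then show ?thesis using 1 2 by (simp add: algebra_simps)
  qed
  then have "\<bar>T ?g - ?I\<bar> \<le> 0"
    by (intro le_zero_if_le_mult_eps[of "2 * C * M * ?c"]) (use C M in auto)
  then show ?thesis by simp
qed

lemma continuous_compact_support_has_integral: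
  fixes f :: "real^'n \<Rightarrow> real"
  assumes "continuous_on UNIV f" "{x. f x \<noteq> 0} \<subseteq> cbox a b"
  shows "(f has_integral integral (cbox a b) f) UNIV"
proof (rule has_integral_on_superset)
  show "(f has_integral integral (cbox a b) f) (cbox a b)"
    by (intro integrable_integral integrable_continuous continuous_on_subset[OF assms(1)]) simp
qed (use assms(2) in auto)

text \<open>Substituting \<open>x - h\<close> for \<open>h\<close> carries the box to a reflected
  one. Because the supports lie in the original box, both integrals extend to the whole space, where
  they agree.\<close>

lemma box_conv_commute:
  fixes \<phi> \<psi> :: "real^'n \<Rightarrow> real"
  assumes "continuous_on UNIV \<phi>" "continuous_on UNIV \<psi>"
    "{x. \<phi> x \<noteq> 0} \<subseteq> cbox a b" "{x. \<psi> x \<noteq> 0} \<subseteq> cbox a b"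
  shows "box_conv a b \<phi> \<psi> = box_conv a b \<psi> \<phi>"
proof
  fix x
  have c: "continuous_on UNIV (\<lambda>h. \<phi> (x - h) * \<psi> h)"
    if "continuous_on UNIV \<phi>" "continuous_on UNIV \<psi>" for \<phi> \<psi> :: "real^'n \<Rightarrow> real"
    by (intro continuous_intros continuous_on_compose2[OF that(1)] that(2)) auto
  have 1: "((\<lambda>h. \<phi> (x - h) * \<psi> h) has_integral box_conv a b \<phi> \<psi> x) (cbox a b)"
    unfolding box_conv_def
    by (intro integrable_integral integrable_continuous continuous_on_subset[OF c[OF assms(1,2)]]) simp
  \<comment> \<open>This is the set of all \<open>x - h\<close> with \<open>h\<close> in the box, in
    the form that \<open>has_integral_affinity\<close> produces for the factor -1.\<close>
  let ?S = "(\<lambda>h. (1 / (-1)) *\<^sub>R h + - ((1 / (-1)) *\<^sub>R x)) ` cbox a b"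
  have "((\<lambda>h. \<phi> (x - ((-1) *\<^sub>R h + x)) * \<psi> ((-1) *\<^sub>R h + x)) has_integral
      (1 / \<bar>-1\<bar> ^ DIM(real^'n)) *\<^sub>R box_conv a b \<phi> \<psi> x) ?S"
    by (rule has_integral_affinity[OF 1]) simp
  then have "((\<lambda>h. \<psi> (x - h) * \<phi> h) has_integral box_conv a b \<phi> \<psi> x) ?S"
    by (simp add: mult.commute)
  then have "((\<lambda>h. \<psi> (x - h) * \<phi> h) has_integral box_conv a b \<phi> \<psi> x) UNIV"
  proof (rule has_integral_on_superset)
    fix h assume h: "h \<notin> ?S"
    have "x - h \<notin> cbox a b"
    proof
      assume "x - h \<in> cbox a b"
      then have "h \<in> ?S" by (intro image_eqI[of _ _ "x - h"]) auto
      then show False using h by simp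
    qed
    then show "\<psi> (x - h) * \<phi> h = 0" using assms(4) by auto
  qed simp
  moreover have "((\<lambda>h. \<psi> (x - h) * \<phi> h) has_integral box_conv a b \<psi> \<phi> x) UNIV"
    unfolding box_conv_def
    by (rule continuous_compact_support_has_integral[OF c[OF assms(2,1)]]) (use assms(3) in auto)
  ultimately show "box_conv a b \<phi> \<psi> x = box_conv a b \<psi> \<phi> x" by (rule has_integral_unique)
qed

text \<open>On a box containing both supports \<open>box_conv\<close> is symmetric, and
  \<open>distribution_box_conv\<close> evaluates \<open>T\<close> on it with either factor
  translated.\<close>

lemma distribution_integral_swap:
  fixes T :: "(real^'n \<Rightarrow> real) \<Rightarrow> real"
  assumes T: "distribution T" and \<phi>: "test_fun \<phi>" and \<psi>: "test_fun \<psi>"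
  shows "integral UNIV (\<lambda>h. T (\<lambda>x. \<phi> (x - h)) * \<psi> h) = integral UNIV (\<lambda>h. T (\<lambda>x. \<psi> (x - h)) * \<phi> h)"
proof -
  have "bounded ({x. \<phi> x \<noteq> 0} \<union> {x. \<psi> x \<noteq> 0})" using \<phi> \<psi> by (simp add: test_fun_iff)
  then obtain u where u: "{x. \<phi> x \<noteq> 0} \<union> {x. \<psi> x \<noteq> 0} \<subseteq> cbox (-u) u"
    using bounded_subset_cbox_symmetric by blast
  have c: "continuous_on UNIV \<phi>" "continuous_on UNIV \<psi>"
    using \<phi> \<psi> by (auto intro: smooth_fun_continuous_on test_fun_smooth)
  have "integral UNIV (\<lambda>h. T (\<lambda>x. \<phi> (x - h)) * \<psi> h) = T (box_conv (-u) u \<phi> \<psi>)"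
    if "test_fun \<phi>" "continuous_on UNIV \<psi>" "{x. \<psi> x \<noteq> 0} \<subseteq> cbox (-u) u" for \<phi> \<psi>
    unfolding distribution_box_conv[OF T that(1,2)]
    by (intro integral_unique continuous_compact_support_has_integral continuous_intros
        distribution_shift_continuous T that) (use that(3) in auto)
  moreover have "box_conv (-u) u \<phi> \<psi> = box_conv (-u) u \<psi> \<phi>"
    by (rule box_conv_commute[OF c]) (use u in auto)
  ultimately show ?thesis using \<phi> \<psi> c u by simp
qed

section \<open>Distributions determined by moments\<close>

text \<open>Induction on the functionals. If \<open>m j\<close> vanishes on the common kernel of the
  others, it gets coefficient 0. Otherwise some \<open>f0\<close> in that kernel has
  \<open>m j f0\<close> nonzero, and subtracting the multiple of \<open>m j\<close> that matches
  \<open>T\<close> at \<open>f0\<close> reduces to the others. The predicate \<open>D\<close> stands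
  for a subspace on which everything is linear.\<close>

lemma functional_in_span:
  fixes m :: "'i \<Rightarrow> ('x \<Rightarrow> real) \<Rightarrow> real" and T :: "('x \<Rightarrow> real) \<Rightarrow> real"
  assumes "finite A"
    and D: "\<And>f g a b. D f \<Longrightarrow> D g \<Longrightarrow> D (\<lambda>x. a * f x + b * g x)"
    and m: "\<And>i f g a b. i \<in> A \<Longrightarrow> D f \<Longrightarrow> D g \<Longrightarrow> m i (\<lambda>x. a * f x + b * g x) = a * m i f + b * m i g"
    and T: "\<And>f g a b. D f \<Longrightarrow> D g \<Longrightarrow> T (\<lambda>x. a * f x + b * g x) = a * T f + b * T g"
    and ker: "\<And>f. D f \<Longrightarrow> (\<forall>i\<in>A. m i f = 0) \<Longrightarrow> T f = 0"
  shows "\<exists>c. \<forall>f. D f \<longrightarrow> T f = (\<Sum>i\<in>A. c i * m i f)"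
  using assms(1) m T ker
proof (induction A arbitrary: T rule: finite_induct)
  case empty
  then show ?case by simp
next
  case (insert j A)
  show ?case
  proof (cases "\<forall>f. D f \<longrightarrow> (\<forall>i\<in>A. m i f = 0) \<longrightarrow> m j f = 0")
    case True
    have "\<exists>c. \<forall>f. D f \<longrightarrow> T f = (\<Sum>i\<in>A. c i * m i f)"
    proof (rule insert.IH)
      show "T f = 0" if "D f" "\<forall>i\<in>A. m i f = 0" for f
        using insert.prems(3)[of f] that True by auto
    qed (use insert.prems(1,2) in auto)
    then obtain c where c: "\<forall>f. D f \<longrightarrow> T f = (\<Sum>i\<in>A. c i * m i f)" by blast
    have "(\<Sum>i\<in>insert j A. (c(j := 0)) i * m i f) = (\<Sum>i\<in>A. c i * m i f)" for f
      using insert.hyps by (simp add: sum.insert) (rule sum.cong, auto)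
    then show ?thesis using c by (intro exI[of _ "c(j := 0)"]) simp
  next
    case False
    then obtain f0 where f0: "D f0" "\<forall>i\<in>A. m i f0 = 0" "m j f0 \<noteq> 0" by blast
    define k where "k = T f0 / m j f0"
    have "\<exists>c. \<forall>f. D f \<longrightarrow> T f - k * m j f = (\<Sum>i\<in>A. c i * m i f)"
    proof (rule insert.IH)
      fix f g a b assume fg: "D f" "D g"
      show "T (\<lambda>x. a * f x + b * g x) - k * m j (\<lambda>x. a * f x + b * g x) = a * (T f - k * m j f) + b * (T g - k * m j g)"
        using insert.prems(1)[of j, OF _ fg] insert.prems(2)[OF fg] by (simp add: algebra_simps)
    next
      fix f assume f: "D f" "\<forall>i\<in>A. m i f = 0"
      \<comment> \<open>This combination lies in the kernel of \<open>m j\<close> as well as of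
        every \<open>m i\<close> with \<open>i\<close> in \<open>A\<close>.\<close>
      let ?f = "\<lambda>x. m j f0 * f x + (- m j f) * f0 x"
      have "T ?f = 0"
      proof (rule insert.prems(3))
        show "D ?f" by (intro D f f0)
        show "\<forall>i\<in>insert j A. m i ?f = 0"
        proof
          fix i assume "i \<in> insert j A"
          then show "m i ?f = 0"
            using insert.prems(1)[of i f f0 "m j f0" "- m j f"] f f0 by auto
        qed
      qed
      then have "m j f0 * T f = m j f * T f0"
        using insert.prems(2)[OF f(1) f0(1), of "m j f0" "- m j f"] by simp
      then show "T f - k * m j f = 0" using f0(3) by (simp add: k_def field_simps)
    qed (use insert.prems(1) in auto)
    then obtain c where c: "\<forall>f. D f \<longrightarrow> T f - k * m j f = (\<Sum>i\<in>A. c i * m i f)" by blast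
    have "(\<Sum>i\<in>insert j A. (c(j := k)) i * m i f) = k * m j f + (\<Sum>i\<in>A. c i * m i f)" for f
      using insert.hyps by (simp add: sum.insert) (rule sum.cong, auto)
    then show ?thesis using c by (intro exI[of _ "c(j := k)"]) (auto simp: algebra_simps)
  qed
qed

lemma poly_fun_leD:
  assumes "poly_fun_le N g"
  obtains c where "g = (\<lambda>x. \<Sum>\<alpha>\<in>{\<alpha>. \<forall>i. \<alpha> i \<le> N}. c \<alpha> * (\<Prod>i\<in>UNIV. (x $ i) ^ (\<alpha> i)))"
  using assms unfolding poly_fun_le_def by blast

lemma monomial_test_integrable:
  fixes \<phi> :: "real^'n \<Rightarrow> real"
  assumes "test_fun \<phi>"
  shows "(\<lambda>x. (\<Prod>i\<in>UNIV. (x $ i) ^ (\<alpha> i)) * \<phi> x) integrable_on UNIV"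
proof -
  obtain u where "{x. \<phi> x \<noteq> 0} \<subseteq> cbox (-u) u"
    using bounded_subset_cbox_symmetric assms unfolding test_fun_iff by blast
  then show ?thesis
    by (intro has_integral_integrable[OF continuous_compact_support_has_integral[of _ "-u" u]]
        continuous_intros smooth_fun_continuous_on test_fun_smooth assms) auto
qed

lemma integral_poly_test:
  fixes \<phi> :: "real^'n \<Rightarrow> real"
  assumes "test_fun \<phi>"
  shows "integral UNIV (\<lambda>x. (\<Sum>\<alpha>\<in>{\<alpha>. \<forall>i. \<alpha> i \<le> N}. c \<alpha> * (\<Prod>i\<in>UNIV. (x $ i) ^ (\<alpha> i))) * \<phi> x)
    = (\<Sum>\<alpha>\<in>{\<alpha>. \<forall>i. \<alpha> i \<le> N}. c \<alpha> * integral UNIV (\<lambda>x. (\<Prod>i\<in>UNIV. (x $ i) ^ (\<alpha> i)) * \<phi> x))"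
proof -
  have "integral UNIV (\<lambda>x. \<Sum>\<alpha>\<in>{\<alpha>. \<forall>i. \<alpha> i \<le> N}. c \<alpha> * ((\<Prod>i\<in>UNIV. (x $ i) ^ (\<alpha> i)) * \<phi> x))
    = (\<Sum>\<alpha>\<in>{\<alpha>. \<forall>i. \<alpha> i \<le> N}. integral UNIV (\<lambda>x. c \<alpha> * ((\<Prod>i\<in>UNIV. (x $ i) ^ (\<alpha> i)) * \<phi> x)))"
    by (rule integral_sum) (auto intro!: integrable_on_mult_right monomial_test_integrable assms finite_exponents)
  then show ?thesis by (simp add: sum_distrib_right mult.assoc)
qed

text \<open>By \<open>functional_in_span\<close> it suffices that \<open>T\<close> vanishes on test
  functions whose moments with exponents up to \<open>N\<close> are zero. The coefficients of the
  moments are then those of the density.\<close>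

lemma poly_dist_if_shifts_poly:
  fixes T :: "(real^'n \<Rightarrow> real) \<Rightarrow> real"
  assumes T: "distribution T"
    and poly: "\<And>\<phi>. test_fun \<phi> \<Longrightarrow> poly_fun_le N (\<lambda>h. T (\<lambda>x. \<phi> (x - h)))"
  shows "poly_dist T"
\<comment> \<open>If every test function is zero, then so is \<open>T\<close>, and the polynomial 0
  represents it. Otherwise a nonzero test function is at hand.\<close>
proof (cases "\<exists>(\<psi>0 :: real^'n \<Rightarrow> real) x0. test_fun \<psi>0 \<and> \<psi>0 x0 \<noteq> 0")
  case False
  then have "T \<phi> = 0" if "test_fun \<phi>" for \<phi>
  proof -
    have "\<phi> = (\<lambda>x. 0)" using False that by (intro ext) blast
    then show ?thesis using distribution_zero[OF T] by simp
  qed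
  moreover have "poly_fun (\<lambda>x::real^'n. 0)" by (rule poly_fun_le_imp_poly_fun[OF poly_fun_le_const[of 0]])
  ultimately show ?thesis unfolding poly_dist_def by (intro exI[of _ "\<lambda>x. 0"]) auto
next
  case True
  then obtain \<psi>0 :: "real^'n \<Rightarrow> real" and x0 where "test_fun \<psi>0" "\<psi>0 x0 \<noteq> 0" by blast
  \<comment> \<open>A translation moves the nonzero value to the origin, because
    \<open>T \<phi>\<close> will be the value of \<open>G\<close> at 0.\<close>
  then have "test_fun (\<lambda>x. \<psi>0 (x - (- x0)))" "\<psi>0 (0 - (- x0)) \<noteq> 0"
    using test_fun_shift[of \<psi>0 "- x0"] by simp_all
  then obtain \<psi>1 where \<psi>1: "test_fun \<psi>1" "\<psi>1 (0 :: real^'n) \<noteq> 0" by blast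
  let ?A = "{\<alpha> :: 'n \<Rightarrow> nat. \<forall>i. \<alpha> i \<le> N}"
  define m where "m \<alpha> \<phi> = integral UNIV (\<lambda>x. (\<Prod>i\<in>UNIV. (x $ i) ^ (\<alpha> i)) * \<phi> x)"
    for \<alpha> :: "'n \<Rightarrow> nat" and \<phi> :: "real^'n \<Rightarrow> real"
  have "\<exists>c. \<forall>\<phi>. test_fun \<phi> \<longrightarrow> T \<phi> = (\<Sum>\<alpha>\<in>?A. c \<alpha> * m \<alpha> \<phi>)"
  proof (rule functional_in_span[OF finite_exponents])
    fix \<phi> \<psi> :: "real^'n \<Rightarrow> real" and a b
    assume t: "test_fun \<phi>" "test_fun \<psi>"
    show "test_fun (\<lambda>x. a * \<phi> x + b * \<psi> x)" by (rule test_fun_lincomb[OF t])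
    show "T (\<lambda>x. a * \<phi> x + b * \<psi> x) = a * T \<phi> + b * T \<psi>" by (rule distribution_lincomb[OF T t])
    fix \<alpha> :: "'n \<Rightarrow> nat"
    note int = monomial_test_integrable[OF t(1), of \<alpha>] monomial_test_integrable[OF t(2), of \<alpha>]
    have "m \<alpha> (\<lambda>x. a * \<phi> x + b * \<psi> x)
        = integral UNIV (\<lambda>x. a * ((\<Prod>i\<in>UNIV. (x $ i) ^ (\<alpha> i)) * \<phi> x) + b * ((\<Prod>i\<in>UNIV. (x $ i) ^ (\<alpha> i)) * \<psi> x))"
      by (simp add: m_def algebra_simps)
    also have "\<dots> = a * m \<alpha> \<phi> + b * m \<alpha> \<psi>"
      unfolding m_def by (subst integral_add) (auto intro!: integrable_on_mult_right int)
    finally show "m \<alpha> (\<lambda>x. a * \<phi> x + b * \<psi> x) = a * m \<alpha> \<phi> + b * m \<alpha> \<psi>" .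
  next
    fix \<phi> assume \<phi>: "test_fun \<phi>" and m0: "\<forall>\<alpha>\<in>?A. m \<alpha> \<phi> = 0"
    define G where "G h = T (\<lambda>x. \<phi> (x - h))" for h
    have G: "smooth_fun G"
      unfolding G_def by (rule poly_fun_smooth[OF poly_fun_le_imp_poly_fun[OF poly[OF \<phi>]]])
    \<comment> \<open>Then \<open>G \<psi> = (G \<psi>1)\<^sup>2\<close>, so the vanishing of its integral forces \<open>G 0 = 0\<close>. Building \<open>\<psi>\<close> from a
      given nonzero test function avoids constructing a bump function.\<close>
    define \<psi> where "\<psi> x = G x * (\<psi>1 x * \<psi>1 x)" for x
    have \<psi>: "test_fun \<psi>" unfolding \<psi>_def by (intro test_fun_mult G \<psi>1 test_fun_smooth)
    obtain c where c: "(\<lambda>h. T (\<lambda>x. \<psi> (x - h))) = (\<lambda>x. \<Sum>\<alpha>\<in>?A. c \<alpha> * (\<Prod>i\<in>UNIV. (x $ i) ^ (\<alpha> i)))"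
      using poly_fun_leD[OF poly[OF \<psi>]] by blast
    have "integral UNIV (\<lambda>h. G h * \<psi> h) = integral UNIV (\<lambda>h. T (\<lambda>x. \<psi> (x - h)) * \<phi> h)"
      unfolding G_def by (rule distribution_integral_swap[OF T \<phi> \<psi>])
    \<comment> \<open>The values of \<open>T\<close> on translates of \<open>\<psi>\<close> form a
      polynomial in \<open>h\<close> with exponents at most \<open>N\<close>, so the integral
      against \<open>\<phi>\<close> involves only moments that vanish.\<close>
    also have "\<dots> = (\<Sum>\<alpha>\<in>?A. c \<alpha> * m \<alpha> \<phi>)"
      unfolding m_def fun_cong[OF c] by (rule integral_poly_test[OF \<phi>])
    also have "\<dots> = 0" using m0 by simp
    finally have I0: "integral UNIV (\<lambda>h. G h * \<psi> h) = 0" .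
    \<comment> \<open>The added ball guarantees that the open box contains 0 whether or not
      \<open>\<psi> 0\<close> vanishes; \<open>has_integral_0_cbox_imp_0\<close> requires a box with
      nonempty interior.\<close>
    have "bounded ({x. \<psi> x \<noteq> 0} \<union> ball 0 1)" using \<psi> by (simp add: test_fun_iff)
    then obtain u where u: "{x. \<psi> x \<noteq> 0} \<union> ball 0 1 \<subseteq> box (-u) u"
      using bounded_subset_box_symmetric by blast
    have cont: "continuous_on UNIV (\<lambda>h. G h * \<psi> h)"
      by (intro continuous_intros smooth_fun_continuous_on G test_fun_smooth[OF \<psi>])
    have "((\<lambda>h. G h * \<psi> h) has_integral integral (cbox (-u) u) (\<lambda>h. G h * \<psi> h)) UNIV"
      by (rule continuous_compact_support_has_integral[OF cont]) (use u box_subset_cbox[of "-u" u] in auto)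
    then have J0: "integral (cbox (-u) u) (\<lambda>h. G h * \<psi> h) = 0" using I0 integral_unique by metis
    have int: "(\<lambda>h. G h * \<psi> h) integrable_on cbox (-u) u"
      by (intro integrable_continuous continuous_on_subset[OF cont]) simp
    have zero: "0 \<in> box (-u) u" using u by auto
    have "G 0 * \<psi> 0 = 0"
    proof (rule has_integral_0_cbox_imp_0[of "-u" u])
      show "continuous_on (cbox (-u) u) (\<lambda>h. G h * \<psi> h)" by (rule continuous_on_subset[OF cont]) simp
      show "((\<lambda>h. G h * \<psi> h) has_integral 0) (cbox (-u) u)" using integrable_integral[OF int] J0 by simp
      show "0 \<le> G x * \<psi> x" for x
      proof -
        have "G x * \<psi> x = (G x * \<psi>1 x)\<^sup>2" by (simp add: \<psi>_def power2_eq_square algebra_simps)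
        then show ?thesis by simp
      qed
      show "box (-u) u \<noteq> {}" "0 \<in> cbox (-u) u" using zero box_subset_cbox[of "-u" u] by auto
    qed
    then have "G 0 = 0" using \<psi>1(2) by (simp add: \<psi>_def)
    then show "T \<phi> = 0" by (simp add: G_def)
  qed
  then obtain c where c: "\<And>\<phi>. test_fun \<phi> \<Longrightarrow> T \<phi> = (\<Sum>\<alpha>\<in>?A. c \<alpha> * m \<alpha> \<phi>)" by blast
  let ?p = "\<lambda>x::real^'n. \<Sum>\<alpha>\<in>?A. c \<alpha> * (\<Prod>i\<in>UNIV. (x $ i) ^ (\<alpha> i))"
  have "poly_fun ?p" unfolding poly_fun_def by blast
  moreover have "T \<phi> = integral UNIV (\<lambda>x. ?p x * \<phi> x)" if "test_fun \<phi>" for \<phi>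
    unfolding integral_poly_test[OF that] using c[OF that] by (simp add: m_def)
  ultimately show ?thesis unfolding poly_dist_def by blast
qed

section \<open>Rotations and the two cases of the theorem\<close>

lemma SO_group_inv:
  fixes P :: "real^'n^'n"
  assumes "P \<in> SO_group"
  shows "matrix_inv P = transpose P" "P *v (transpose P *v x) = x" "transpose P *v (P *v x) = x"
    "orthogonal_matrix P" "orthogonal_matrix (transpose P)" "det P = 1"
proof -
  have o: "transpose P ** P = mat 1" "P ** transpose P = mat 1"
    using assms by (auto simp: SO_group_def orthogonal_matrix_def)
  have "\<exists>A. P ** A = mat 1 \<and> A ** P = mat 1" using o by blast
  then have inv: "P ** matrix_inv P = mat 1 \<and> matrix_inv P ** P = mat 1"
    unfolding matrix_inv_def by (rule someI_ex)
  have "matrix_inv P = (transpose P ** P) ** matrix_inv P" by (simp add: o)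
  also have "\<dots> = transpose P ** (P ** matrix_inv P)" by (simp only: matrix_mul_assoc)
  also have "\<dots> = transpose P" by (simp add: inv)
  finally show "matrix_inv P = transpose P" .
  show "P *v (transpose P *v x) = x" "transpose P *v (P *v x) = x"
    by (simp_all only: matrix_vector_mul_assoc o matrix_vector_mul_lid)
  show "orthogonal_matrix P" "orthogonal_matrix (transpose P)" "det P = 1"
    using assms by (auto simp: SO_group_def orthogonal_matrix_def)
qed

theorem mainTheorem9:
  fixes G :: "(real^'n^'n) set"
  assumes "CARD('n) \<ge> 2"
    and "G = SO_group \<or> G = O_group"
  shows "(\<forall>(V :: (real^'n \<Rightarrow> real) set) f.
            fin_dim_subspace V \<and> (\<forall>g\<in>V. continuous_on UNIV g) \<and>
            (\<forall>h. tau_fun h ` V \<subseteq> V) \<and> (\<forall>P\<in>G. O_fun P ` V \<subseteq> V) \<and> f \<in> V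
            \<longrightarrow> poly_fun f)
       \<and> (\<forall>(V :: ((real^'n \<Rightarrow> real) \<Rightarrow> real) set) f.
            fin_dim_subspace V \<and> (\<forall>T\<in>V. distribution T) \<and>
            (\<forall>h. tau_dist h ` V \<subseteq> V) \<and> (\<forall>P\<in>G. O_dist P ` V \<subseteq> V) \<and> f \<in> V
            \<longrightarrow> poly_dist f)"
proof (intro conjI allI impI; elim conjE)
  have G: "P \<in> G" if "P \<in> SO_group" for P
    using assms(2) that by (auto simp: SO_group_def O_group_def)
  {
    fix V :: "(real^'n \<Rightarrow> real) set" and f
    assume V: "fin_dim_subspace V" and cont: "\<forall>g\<in>V. continuous_on UNIV g"
      and tau: "\<forall>h. tau_fun h ` V \<subseteq> V" and O: "\<forall>P\<in>G. O_fun P ` V \<subseteq> V" and f: "f \<in> V"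
    interpret motion_space V "\<lambda>h x. x + h" "\<lambda>P x. P *v x"
    proof
      show "fin_dim_subspace V" by fact
      show "(\<lambda>x. g (x + h)) \<in> V" if "g \<in> V" for g h
        using tau that unfolding tau_fun_def by blast
      show "2 \<le> CARD('n)" by fact
      fix P :: "real^'n^'n" assume P: "P \<in> SO_group"
      show "(\<lambda>x. g (P *v x)) \<in> V" if "g \<in> V" for g
        using O G[OF P] that unfolding O_fun_def by blast
      show "g x = 0" if "\<And>x. g (P *v x) = 0" for g :: "real^'n \<Rightarrow> real" and x
        using that[of "transpose P *v x"] by (simp only: SO_group_inv(2)[OF P])
    qed (simp_all add: algebra_simps matrix_vector_right_distrib)
    obtain n where n: "\<forall>f\<in>V. \<forall>h x. \<exists>d. \<forall>k. f (x + real k *\<^sub>R h) = (\<Sum>j\<le>n. real (k choose j) * d j)"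
      using newton_expansion by blast
    show "poly_fun f"
      by (rule poly_fun_le_imp_poly_fun, rule newton_imp_poly_fun_le[of _ n]) (use cont f n in auto)
  }
  {
    fix V :: "((real^'n \<Rightarrow> real) \<Rightarrow> real) set" and f
    assume V: "fin_dim_subspace V" and dist: "\<forall>T\<in>V. distribution T"
      and tau: "\<forall>h. tau_dist h ` V \<subseteq> V" and O: "\<forall>P\<in>G. O_dist P ` V \<subseteq> V" and f: "f \<in> V"
    \<comment> \<open>The space acted on consists of all functions, test functions or not. For a
      rotation the inverse is the transpose and the determinant is 1, so \<open>O_dist P\<close>
      becomes plain composition with \<open>transpose P\<close>.\<close>
    interpret motion_space V "\<lambda>h \<phi> x. \<phi> (x - h)" "\<lambda>P \<phi> x. \<phi> (transpose P *v x)"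
    proof
      show "fin_dim_subspace V" by fact
      show "(\<lambda>\<phi>. T (\<lambda>x. \<phi> (x - h))) \<in> V" if T: "T \<in> V" for T h
      proof -
        have "(\<lambda>\<phi>. T (\<lambda>x. \<phi> (x - h))) = tau_dist h T"
          unfolding tau_dist_def using distribution_nontest[of T] dist T
          by (auto simp: fun_eq_iff test_fun_shift_iff)
        then show ?thesis using tau T by auto
      qed
      show "2 \<le> CARD('n)" by fact
      fix P :: "real^'n^'n" assume P: "P \<in> SO_group"
      note inv = SO_group_inv[OF P]
      show "(\<lambda>\<phi>. T (\<lambda>x. \<phi> (transpose P *v x))) \<in> V" if T: "T \<in> V" for T
      proof -
        have "T (\<lambda>x. \<phi> (transpose P *v x)) = O_dist P T \<phi>" for \<phi>
        proof (cases "test_fun \<phi>")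
          \<comment> \<open>Both sides are 0 here: rotating back by \<open>P\<close> shows that the
            rotated function is no test function either.\<close>
          case False
          have "\<not> test_fun (\<lambda>x. \<phi> (transpose P *v x))"
          proof
            assume "test_fun (\<lambda>x. \<phi> (transpose P *v x))"
            from test_fun_compose_orthogonal[OF this inv(4)] False show False by (simp only: inv(3))
          qed
          then show ?thesis using False distribution_nontest dist T by (auto simp: O_dist_def)
        qed (simp add: O_dist_def inv(1,6))
        then have "(\<lambda>\<phi>. T (\<lambda>x. \<phi> (transpose P *v x))) = O_dist P T" by (rule ext)
        then show ?thesis using O G[OF P] T by auto
      qed
      show "T \<phi> = 0" if "\<And>\<phi>. T (\<lambda>x. \<phi> (transpose P *v x)) = 0" for T :: "(real^'n \<Rightarrow> real) \<Rightarrow> real" and \<phi>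
        using that[of "\<lambda>x. \<phi> (P *v x)"] by (simp only: inv(2))
      show "(\<lambda>x. \<phi> (transpose P *v x - h)) = (\<lambda>x. \<phi> (transpose P *v (x - P *v h)))" for \<phi> :: "real^'n \<Rightarrow> real" and h
        by (simp only: matrix_vector_mult_diff_distrib inv(3))
    qed (simp_all add: algebra_simps)
    obtain n where n: "\<forall>T\<in>V. \<forall>h \<phi>. \<exists>d. \<forall>k. T (\<lambda>x. \<phi> (x - real k *\<^sub>R h)) = (\<Sum>j\<le>n. real (k choose j) * d j)"
      using newton_expansion by blast
    show "poly_dist f"
    proof (rule poly_dist_if_shifts_poly)
      show df: "distribution f" using dist f by blast
      fix \<phi> :: "real^'n \<Rightarrow> real" assume \<phi>: "test_fun \<phi>"
      show "poly_fun_le (n * CARD('n)) (\<lambda>h. f (\<lambda>x. \<phi> (x - h)))"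
      proof (rule newton_imp_poly_fun_le)
        show "continuous_on UNIV (\<lambda>h. f (\<lambda>x. \<phi> (x - h)))" by (rule distribution_shift_continuous[OF df \<phi>])
        fix y h :: "real^'n"
        \<comment> \<open>Absorbing the base point \<open>y\<close> into the test function reduces a
          progression starting at \<open>y\<close> to one starting at 0.\<close>
        have "(\<lambda>x. \<phi> (x - (y + real k *\<^sub>R h))) = (\<lambda>x. (\<lambda>x. \<phi> (x - y)) (x - real k *\<^sub>R h))" for k
          by (simp add: algebra_simps)
        then show "\<exists>d. \<forall>k. f (\<lambda>x. \<phi> (x - (y + real k *\<^sub>R h))) = (\<Sum>j\<le>n. real (k choose j) * d j)"
          using n[rule_format, OF f, of "\<lambda>x. \<phi> (x - y)" h] by (simp only:)
      qed
    qed
  }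
qed

end
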